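(* For $\alpha,\beta>-1$ let $\{\phi_i\}_{i\in\mathbb N}$ be the orthonormal Jacobi polynomial basis, $T=\{t_n\}_{n=1}^N\subseteq[-1,1]$ a set of scattered points with density $h$. Then for each $0<\epsilon<1$ there exists $c(\epsilon)>0$ such that if $h\le c(\epsilon)M^{-2}$, then the least-squares problem $\min_{z\in\mathbb C^M}\|UP_Mz-y\|$ has a unique solution $\check x$, and it satisfies $$\|x-\check x\|\le\left(1+\frac1{\sqrt{1-\epsilon}}\right)\|x-P_Mx\|_{1,w}+\frac1{\sqrt{1-\epsilon}}\eta$$ for any weights $w=\{w_i\}_{i\in\mathbb N}$ with $w_i\ge\|\phi_i\|_{L^\infty}$.
   Context: Jacobi setting: $D=(-1,1)$, $\nu(t)=c^{(\alpha,\beta)}(1-t)^\alpha(1+t)^\beta$ normalized so $\int\nu=1$; $\phi_j$ is the degree-$(j-1)$ Jacobi polynomial $P^{(\alpha,\beta)}_{j-1}$ rescaled so $\{\phi_j\}$ is orthonormal in $L^2_\nu$. Density $h=\sup_{t\in(-1,1)}\min_n|t-t_n|$; Voronoi cells $V_n=\{t\in(-1,1):|t-t_n|\le|t-t_m|\ \forall m\ne n\}$; quadrature weights $\tau_n=\int_{V_n}\nu$. $U$ is the $N\times\infty$ matrix $U_{n,i}=\sqrt{\tau_n}\phi_i(t_n)$; $P_M$ the projection onto the first $M$ coordinates ($\mathbb C^M$ identified with sequences supported there). Target $f=\sum_ix_i\phi_i$ with coefficient sequence $x$; data $y=\{\sqrt{\tau_n}(f(t_n)+e_n)\}$, $|e_n|\le\eta$.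 $\|z\|_{1,w}=\sum_iw_i|z_i|$, $\|\cdot\|$ the $\ell^2$ norm. *)

theory Defs
  imports "HOL-Analysis.Analysis"
begin

text \<open>Jacobi polynomial P_n^(a,b) via the explicit finite-sum formula
  (standard normalisation, positive leading coefficient).\<close>
definition jacobiP :: "real \<Rightarrow> real \<Rightarrow> nat \<Rightarrow> real \<Rightarrow> real" where
  "jacobiP a b n x =
     (\<Sum>s\<le>n. ((real n + a) gchoose (n - s)) * ((real n + b) gchoose s)
              * ((x - 1) / 2) ^ s * ((x + 1) / 2) ^ (n - s))"

definition jacobi_weight_raw :: "real \<Rightarrow> real \<Rightarrow> real \<Rightarrow> real" where
  "jacobi_weight_raw a b s = (1 - s) powr a * (1 + s) powr b"

definition jacobi_nu :: "real \<Rightarrow> real \<Rightarrow> real \<Rightarrow> real" where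
  "jacobi_nu a b s = jacobi_weight_raw a b s / (LINT u:{-1<..<1}|lborel. jacobi_weight_raw a b u)"

text \<open>Orthonormal Jacobi basis, 0-based: jacobi_phi a b i is the rescaled P_i
  (the paper's phi_(i+1)).\<close>
definition jacobi_phi :: "real \<Rightarrow> real \<Rightarrow> nat \<Rightarrow> real \<Rightarrow> real" where
  "jacobi_phi a b i s = jacobiP a b i s /
     sqrt (LINT u:{-1<..<1}|lborel. jacobi_nu a b u * (jacobiP a b i u)^2)"

definition jacobi_f :: "real \<Rightarrow> real \<Rightarrow> (nat \<Rightarrow> complex) \<Rightarrow> real \<Rightarrow> complex" where
  "jacobi_f a b x s = (\<Sum>i. x i * complex_of_real (jacobi_phi a b i s))"

definition point_density :: "nat \<Rightarrow> (nat \<Rightarrow> real) \<Rightarrow> real" where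
  "point_density N t = (SUP s\<in>{-1<..<1}. Min ((\<lambda>n. \<bar>s - t n\<bar>) ` {..<N}))"

definition voronoi_cell :: "nat \<Rightarrow> (nat \<Rightarrow> real) \<Rightarrow> nat \<Rightarrow> real set" where
  "voronoi_cell N t n = {s\<in>{-1<..<1}. \<forall>m<N. m \<noteq> n \<longrightarrow> \<bar>s - t n\<bar> \<le> \<bar>s - t m\<bar>}"

definition quad_weight :: "real \<Rightarrow> real \<Rightarrow> nat \<Rightarrow> (nat \<Rightarrow> real) \<Rightarrow> nat \<Rightarrow> real" where
  "quad_weight a b N t n = (LINT s:voronoi_cell N t n|lborel. jacobi_nu a b s)"

definition Umat :: "real \<Rightarrow> real \<Rightarrow> nat \<Rightarrow> (nat \<Rightarrow> real) \<Rightarrow> nat \<Rightarrow> nat \<Rightarrow> complex" where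
  "Umat a b N t n i = complex_of_real (sqrt (quad_weight a b N t n) * jacobi_phi a b i (t n))"

definition projM :: "nat \<Rightarrow> (nat \<Rightarrow> complex) \<Rightarrow> nat \<Rightarrow> complex" where
  "projM M z = (\<lambda>i. if i < M then z i else 0)"

text \<open>(U P_M z)_n; P_M z is supported in {..<M}, so the row sum is finite.\<close>
definition UPM :: "real \<Rightarrow> real \<Rightarrow> nat \<Rightarrow> (nat \<Rightarrow> real) \<Rightarrow> nat \<Rightarrow> (nat \<Rightarrow> complex) \<Rightarrow> nat \<Rightarrow> complex" where
  "UPM a b N t M z n = (\<Sum>i<M. Umat a b N t n i * projM M z i)"

definition lsq_residual :: "real \<Rightarrow> real \<Rightarrow> nat \<Rightarrow> (nat \<Rightarrow> real) \<Rightarrow> nat \<Rightarrow> (nat \<Rightarrow> complex) \<Rightarrow> (nat \<Rightarrow> complex) \<Rightarrow> real" where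
  "lsq_residual a b N t M y z = sqrt (\<Sum>n<N. (cmod (UPM a b N t M z n - y n))^2)"

definition lsq_solution :: "real \<Rightarrow> real \<Rightarrow> nat \<Rightarrow> (nat \<Rightarrow> real) \<Rightarrow> nat \<Rightarrow> (nat \<Rightarrow> complex) \<Rightarrow> (nat \<Rightarrow> complex) \<Rightarrow> bool" where
  "lsq_solution a b N t M y z \<longleftrightarrow> (\<forall>i\<ge>M. z i = 0) \<and>
     (\<forall>z'. (\<forall>i\<ge>M. z' i = 0) \<longrightarrow> lsq_residual a b N t M y z \<le> lsq_residual a b N t M y z')"

definition l2norm :: "(nat \<Rightarrow> complex) \<Rightarrow> real" where
  "l2norm z = sqrt (\<Sum>i. (cmod (z i))^2)"

definition wl1norm :: "(nat \<Rightarrow> real) \<Rightarrow> (nat \<Rightarrow> complex) \<Rightarrow> real" where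
  "wl1norm w z = (\<Sum>i. w i * cmod (z i))"

end

theory Submission
  imports Defs
begin

text \<open>Let \<open>E\<close> denote integration against \<open>\<nu>\<close>. The Jacobi operator is symmetric for \<open>E\<close> with eigenvalues
  \<open>k (k + a + b + 1)\<close>, which gives the Bernstein inequality
  \<open>E ((1 - x\<^sup>2) p'\<^sup>2) \<le> C n\<^sup>2 E (p\<^sup>2)\<close> for polynomials of degree below \<open>n\<close>. An integration by parts
  turns it into \<open>E (q\<^sup>2) \<le> C n\<^sup>2 E ((1 - x\<^sup>2) q\<^sup>2)\<close>, and both together give the Markov inequality
  \<open>E (p'\<^sup>2) \<le> (C n\<^sup>2)\<^sup>2 E (p\<^sup>2)\<close>. Iterating it and summing the Taylor series of \<open>p\<close> from \<open>s\<close> to the nearest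
  sample point shows that replacing \<open>p\<close> by its Voronoi step function changes it in \<open>L\<^sup>2\<close> by at most
  \<open>(exp (C h n\<^sup>2) - 1) \<parallel>p\<parallel>\<close>, so \<open>U P\<^sub>M\<close> is bounded below by \<open>sqrt (1 - \<epsilon>)\<close>. The error
  estimate is then Pythagoras for the least-squares projection.\<close>

section \<open>Polynomials integrated against the Jacobi weight\<close>

lemma set_integral_nonneg:
  fixes f :: "'a \<Rightarrow> real"
  assumes "\<And>x. x \<in> A \<Longrightarrow> 0 \<le> f x"
  shows "0 \<le> (LINT x:A|M. f x)"
  unfolding set_lebesgue_integral_def
  using assms by (intro Bochner_Integration.integral_nonneg) (auto simp: indicator_def)

text \<open>Since b + 1 > 0, the antiderivative is continuous up to both endpoints, so the
  fundamental theorem for nonnegative integrands absorbs the possible singularity at -1.\<close>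

lemma set_integrable_one_plus_powr:
  fixes b :: real
  assumes "b > -1"
  shows "set_integrable lborel {-1<..<1} (\<lambda>x. (1 + x) powr b)"
proof -
  define F where "F = (\<lambda>x::real. (1 + x) powr (b + 1) / (b + 1))"
  have c: "continuous_on {-1..1} F"
    unfolding F_def using assms by (intro continuous_intros continuous_on_powr') auto
  have l: "(F \<longlongrightarrow> F (-1)) (at_right (-1))" and r: "(F \<longlongrightarrow> F 1) (at_left 1)"
    using continuous_on_Icc_at_rightD[OF c] continuous_on_Icc_at_leftD[OF c] by simp_all
  have "set_integrable lborel (einterval (ereal (-1)) (ereal 1)) (\<lambda>x. (1 + x) powr b)"
  proof (rule interval_integral_FTC_nonneg(1)[where F = F])
    show "((F \<circ> real_of_ereal) \<longlongrightarrow> F (-1)) (at_right (ereal (-1)))"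
      using l unfolding ereal_tendsto_simps1 .
    show "((F \<circ> real_of_ereal) \<longlongrightarrow> F 1) (at_left (ereal 1))"
      using r unfolding ereal_tendsto_simps1 .
    show "DERIV F x :> (1 + x) powr b" if "ereal (-1) < ereal x" "ereal x < ereal 1" for x
      unfolding F_def using that assms
      by (auto intro!: derivative_eq_intros)
    show "isCont (\<lambda>x. (1 + x) powr b) x" if "ereal (-1) < ereal x" "ereal x < ereal 1" for x
      using that by (auto intro!: continuous_intros)
  qed auto
  then show ?thesis
    by (simp add: einterval_eq)
qed

lemma set_integrable_one_minus_powr:
  fixes a :: real
  assumes "a > -1"
  shows "set_integrable lborel {-1<..<1} (\<lambda>x. (1 - x) powr a)"
proof -
  have "integrable lborel (\<lambda>x. indicator {-1<..<1} x *\<^sub>R (1 + x) powr a)"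
    using set_integrable_one_plus_powr[OF assms] by (simp add: set_integrable_def)
  \<comment> \<open>The reflection is spelled \<open>0 + (-1) * x\<close> to fit the affine change
    of variables.\<close>
  then have "integrable lborel (\<lambda>x. indicator {-1<..<1} (0 + (-1) * x) *\<^sub>R (1 + (0 + (-1) * x)) powr a)"
    by (subst lborel_integrable_real_affine_iff) auto
  moreover have "indicator {-1<..<1::real} (-x) = (indicator {-1<..<1} x :: real)" for x
    by (auto simp: indicator_def)
  ultimately show ?thesis
    by (simp add: set_integrable_def)
qed

text \<open>A vanishing integral would force f = 0 almost everywhere and make the interval a null
  set. The finite set \<open>Z\<close> leaves room for the roots of a polynomial.\<close>

lemma set_integral_pos:
  fixes f :: "real \<Rightarrow> real"
  assumes "l < u" and int: "set_integrable lborel {l<..<u} f" and "finite Z"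
    and nn: "\<And>x. x \<in> {l<..<u} \<Longrightarrow> 0 \<le> f x"
    and pos: "\<And>x. x \<in> {l<..<u} - Z \<Longrightarrow> f x \<noteq> 0"
  shows "0 < (LINT x:{l<..<u}|lborel. f x)"
proof -
  have "0 \<le> (LINT x:{l<..<u}|lborel. f x)"
    using nn by (intro set_integral_nonneg) auto
  moreover have "(LINT x:{l<..<u}|lborel. f x) \<noteq> 0"
  proof
    assume "(LINT x:{l<..<u}|lborel. f x) = 0"
    then have "AE x in lborel. indicator {l<..<u} x *\<^sub>R f x = 0"
      using int nn unfolding set_integrable_def set_lebesgue_integral_def
      by (subst (asm) integral_nonneg_eq_0_iff_AE) (auto simp: indicator_def)
    moreover have "AE x in lborel. x \<notin> Z"
      using \<open>finite Z\<close> by (intro AE_not_in finite_imp_null_set_lborel)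
    ultimately have "AE x in lborel. x \<notin> {l<..<u}"
      by eventually_elim (use pos in \<open>auto simp: indicator_def split: if_splits\<close>)
    then have "{l<..<u} \<in> null_sets lborel"
      by (simp add: AE_iff_null_sets)
    then show False using \<open>l < u\<close> by (simp add: null_sets_def)
  qed
  ultimately show ?thesis by simp
qed

locale jacobi_weight =
  fixes a b :: real
  assumes a: "a > -1" and b: "b > -1"
begin

abbreviation (input) \<rho> where "\<rho> \<equiv> jacobi_weight_raw a b"

lemma weight_measurable [measurable]: "\<rho> \<in> borel_measurable borel"
  unfolding jacobi_weight_raw_def by measurable

lemma weight_nonneg: "0 \<le> \<rho> x"
  by (simp add: jacobi_weight_raw_def)

lemma weight_pos: "x \<in> {-1<..<1} \<Longrightarrow> 0 < \<rho> x"
  by (simp add: jacobi_weight_raw_def)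

text \<open>On each half of the interval one factor has its base in [1,2] and is bounded by a
  constant; only the other one can blow up, and it is integrable.\<close>

lemma set_integrable_weight: "set_integrable lborel {-1<..<1} \<rho>"
proof -
  define K where "K = (2::real) powr \<bar>a\<bar> + 2 powr \<bar>b\<bar>"
  have le: "y powr c \<le> 2 powr \<bar>c\<bar>" if "1 \<le> y" "y \<le> 2" for c y :: real
  proof -
    have "y powr c \<le> y powr \<bar>c\<bar>" using that by (intro powr_mono) auto
    also have "\<dots> \<le> 2 powr \<bar>c\<bar>" using that by (intro powr_mono2) auto
    finally show ?thesis .
  qed
  have "set_integrable lborel {-1<..<1} (\<lambda>x. K * ((1 - x) powr a + (1 + x) powr b))"
    using a b by (intro set_integrable_mult_right set_integral_add
        set_integrable_one_minus_powr set_integrable_one_plus_powr)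
  then show ?thesis
  proof (rule set_integrable_bound)
    show "set_borel_measurable lborel {-1<..<1} \<rho>"
      unfolding set_borel_measurable_def by measurable
    have "\<rho> x \<le> K * ((1 - x) powr a + (1 + x) powr b)" if x: "x \<in> {-1<..<1}" for x
    proof (cases "x \<ge> 0")
      case True
      have "\<rho> x \<le> (1 - x) powr a * K"
        unfolding jacobi_weight_raw_def K_def using le[of "1 + x" b] x True
        by (intro mult_left_mono) (auto intro: add_increasing)
      also have "\<dots> \<le> K * ((1 - x) powr a + (1 + x) powr b)"
        by (simp add: algebra_simps K_def)
      finally show ?thesis .
    next
      case False
      have "\<rho> x \<le> K * (1 + x) powr b"
        unfolding jacobi_weight_raw_def K_def using le[of "1 - x" a] x False
        by (intro mult_right_mono) (auto intro: add_increasing2)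
      also have "\<dots> \<le> K * ((1 - x) powr a + (1 + x) powr b)"
        by (simp add: algebra_simps K_def)
      finally show ?thesis .
    qed
    moreover have "0 \<le> K" by (simp add: K_def)
    ultimately show "AE x in lborel. x \<in> {-1<..<1} \<longrightarrow>
        norm (\<rho> x) \<le> norm (K * ((1 - x) powr a + (1 + x) powr b))"
      by (intro AE_I2) (simp add: weight_nonneg)
  qed
qed

lemma set_integrable_poly_weight:
  "set_integrable lborel {-1<..<1} (\<lambda>x. poly p x * \<rho> x)"
proof -
  have "bounded (poly p ` {-1..1})"
    by (intro compact_imp_bounded compact_continuous_image continuous_intros) auto
  then obtain B where B: "\<And>x. x \<in> {-1..1} \<Longrightarrow> \<bar>poly p x\<bar> \<le> B"
    unfolding bounded_iff by (metis imageI real_norm_def)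
  have [measurable]: "poly p \<in> borel_measurable borel"
    by (intro borel_measurable_continuous_onI continuous_intros)
  have "set_integrable lborel {-1<..<1} (\<lambda>x. B * \<rho> x)"
    by (intro set_integrable_mult_right set_integrable_weight)
  then show ?thesis
  proof (rule set_integrable_bound)
    show "set_borel_measurable lborel {-1<..<1} (\<lambda>x. poly p x * \<rho> x)"
      unfolding set_borel_measurable_def by measurable
    show "AE x in lborel. x \<in> {-1<..<1} \<longrightarrow> norm (poly p x * \<rho> x) \<le> norm (B * \<rho> x)"
    proof (intro AE_I2 impI)
      fix x :: real assume "x \<in> {-1<..<1}"
      then have "\<bar>poly p x\<bar> \<le> \<bar>B\<bar>" using B[of x] by auto
      then show "norm (poly p x * \<rho> x) \<le> norm (B * \<rho> x)"
        by (simp add: abs_mult mult_right_mono)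
    qed
  qed
qed

lemma weight_integral_pos: "0 < (LINT u:{-1<..<1}|lborel. \<rho> u)"
  using weight_pos weight_nonneg
  by (intro set_integral_pos[OF _ set_integrable_weight, of "{}"]) (auto simp: less_imp_neq[symmetric])

lemma nu_nonneg: "0 \<le> jacobi_nu a b x"
  unfolding jacobi_nu_def using weight_integral_pos weight_nonneg by simp

lemma nu_pos: "x \<in> {-1<..<1} \<Longrightarrow> 0 < jacobi_nu a b x"
  unfolding jacobi_nu_def using weight_integral_pos weight_pos by simp

lemma nu_measurable [measurable]: "jacobi_nu a b \<in> borel_measurable borel"
  unfolding jacobi_nu_def by measurable

lemma set_integrable_poly_nu:
  "set_integrable lborel {-1<..<1} (\<lambda>x. poly p x * jacobi_nu a b x)"
  unfolding jacobi_nu_def times_divide_eq_right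
  by (intro set_integrable_divide set_integrable_poly_weight)

text \<open>Taking formal polynomials as arguments makes the functional linear without integrability
  side conditions.\<close>

definition E :: "real poly \<Rightarrow> real" where
  "E p = (LINT x:{-1<..<1}|lborel. poly p x * jacobi_nu a b x)"

lemma E_add: "E (p + q) = E p + E q"
  unfolding E_def using set_integrable_poly_nu
  by (simp add: distrib_right set_integral_add)

lemma E_smult: "E (smult c p) = c * E p"
  unfolding E_def by (simp add: mult.assoc)

lemma E_0 [simp]: "E 0 = 0"
  using E_smult[of 0 0] by simp

lemma E_minus: "E (- p) = - E p"
  using E_smult[of "-1" p] by simp

lemma E_diff: "E (p - q) = E p - E q"
  using E_add[of p "-q"] by (simp add: E_minus)

lemma E_sum: "E (\<Sum>i\<in>I. p i) = (\<Sum>i\<in>I. E (p i))"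
  by (induction I rule: infinite_finite_induct) (simp_all add: E_add)

lemma E_one: "E 1 = 1"
  unfolding E_def jacobi_nu_def using weight_integral_pos by simp

lemma E_nonneg:
  assumes "\<And>x. x \<in> {-1<..<1} \<Longrightarrow> 0 \<le> poly p x"
  shows "0 \<le> E p"
  unfolding E_def using assms nu_nonneg by (intro set_integral_nonneg) auto

lemma E_mono:
  assumes "\<And>x. x \<in> {-1<..<1} \<Longrightarrow> poly p x \<le> poly q x"
  shows "E p \<le> E q"
  using E_nonneg[of "q - p"] assms by (simp add: E_diff)

lemma E_square_pos:
  assumes "p \<noteq> 0"
  shows "0 < E (p * p)"
  unfolding E_def
proof (rule set_integral_pos[OF _ set_integrable_poly_nu])
  show "finite {x. poly p x = 0}" using assms by (rule poly_roots_finite)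
qed (use nu_pos nu_nonneg in \<open>auto simp: less_imp_neq[symmetric]\<close>)

lemma E_square_nonneg: "0 \<le> E (p * p)"
  by (rule E_nonneg) simp

text \<open>Since \<open>a, b > -1\<close>, the function \<open>(1 - x\<^sup>2) r(x) \<rho>(x)\<close> vanishes at both endpoints.\<close>

lemma E_by_parts:
  "E ([:1, 0, -1:] * pderiv r + [:b - a, -(a + b + 2):] * r) = 0"
proof -
  \<comment> \<open>The first-order factor comes from the Pearson equation ((1 - x^2) \<rho>)' = (b
    - a - (a + b + 2) x) \<rho>, so \<open>g\<close> times \<rho> is the derivative of
    \<open>F\<close>.\<close>
  define g where "g = [:1, 0, -1:] * pderiv r + [:b - a, -(a + b + 2):] * r"
  define F where "F = (\<lambda>x. (1 - x) powr (a + 1) * (1 + x) powr (b + 1) * poly r x)"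
  have c: "continuous_on {-1..1} F"
    unfolding F_def using a b by (intro continuous_intros continuous_on_powr') auto
  have F0: "F (-1) = 0" "F 1 = 0" by (simp_all add: F_def)
  have l: "(F \<longlongrightarrow> 0) (at_right (-1))" and r: "(F \<longlongrightarrow> 0) (at_left 1)"
    using continuous_on_Icc_at_rightD[OF c] continuous_on_Icc_at_leftD[OF c] F0 by simp_all
  have "(LBINT x=ereal (-1)..ereal 1. poly g x * \<rho> x) = 0 - 0"
  proof (rule interval_integral_FTC_integrable[where F = F])
    show "((F \<circ> real_of_ereal) \<longlongrightarrow> 0) (at_right (ereal (-1)))"
      using l unfolding ereal_tendsto_simps1 .
    show "((F \<circ> real_of_ereal) \<longlongrightarrow> 0) (at_left (ereal 1))"
      using r unfolding ereal_tendsto_simps1 .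
    show "(F has_vector_derivative poly g x * \<rho> x) (at x)"
      if "ereal (-1) < ereal x" "ereal x < ereal 1" for x
    proof -
      have x: "1 - x > 0" "1 + x > 0" using that by auto
      have p: "(1 - x) powr (a + 1) = (1 - x) * (1 - x) powr a"
          "(1 + x) powr (b + 1) = (1 + x) * (1 + x) powr b"
        using x by (simp_all add: powr_add)
      have d1: "((\<lambda>x. (1 - x) powr (a + 1)) has_real_derivative - (a + 1) * (1 - x) powr a) (at x)"
        using x by (auto intro!: derivative_eq_intros simp: algebra_simps)
      have d2: "((\<lambda>x. (1 + x) powr (b + 1)) has_real_derivative (b + 1) * (1 + x) powr b) (at x)"
        using x by (auto intro!: derivative_eq_intros)
      have "(F has_real_derivative poly g x * \<rho> x) (at x)"
        unfolding F_def
        by (rule DERIV_cong[OF DERIV_mult[OF DERIV_mult[OF d1 d2] poly_DERIV[of r]]])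
          (unfold p g_def jacobi_weight_raw_def, simp add: algebra_simps)
      then show ?thesis
        by (simp add: has_real_derivative_iff_has_vector_derivative)
    qed
    show "isCont (\<lambda>x. poly g x * \<rho> x) x"
      if "ereal (-1) < ereal x" "ereal x < ereal 1" for x
      using that unfolding jacobi_weight_raw_def by (auto intro!: continuous_intros)
    show "set_integrable lborel (einterval (ereal (-1)) (ereal 1)) (\<lambda>x. poly g x * \<rho> x)"
      using set_integrable_poly_weight by (simp add: einterval_eq)
  qed auto
  then have "(LINT x:{-1<..<1}|lborel. poly g x * \<rho> x) = 0"
    by (simp add: interval_lebesgue_integral_def einterval_eq)
  then show ?thesis
    unfolding g_def[symmetric] E_def jacobi_nu_def by simp
qed

end

section \<open>Orthogonality of the Jacobi polynomials\<close>

lemma gbinomial_Suc_mult: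
  fixes x :: "'a::field_char_0"
  shows "of_nat (Suc k) * (x gchoose Suc k) = (x - of_nat k) * (x gchoose k)"
  using gbinomial_absorb_comp[of x k] gbinomial_absorption[of k x] by simp

context jacobi_weight
begin

text \<open>Formal counterpart of \<open>jacobiP\<close>, so that degrees, derivatives and
  \<open>E\<close> apply to it; the two linear factors are (x - 1)/2 and (x + 1)/2.\<close>

definition P :: "nat \<Rightarrow> real poly" where
  "P n = (\<Sum>s\<le>n. smult (((real n + a) gchoose (n - s)) * ((real n + b) gchoose s))
            ([:-1/2, 1/2:] ^ s * [:1/2, 1/2:] ^ (n - s)))"

text \<open>The Jacobi operator p \<mapsto> -((1 - x^2) \<rho> p')' / \<rho>, with the sign that
  makes it nonnegative for \<open>E\<close>.\<close>

definition L :: "real poly \<Rightarrow> real poly" where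
  "L p = - ([:1, 0, -1:] * pderiv (pderiv p) + [:b - a, -(a + b + 2):] * pderiv p)"

definition eig :: "nat \<Rightarrow> real" where
  "eig n = real n * (real n + a + b + 1)"

lemma poly_P: "poly (P n) x = jacobiP a b n x"
  unfolding P_def jacobiP_def poly_sum
  by (intro sum.cong refl) (simp add: field_simps)

lemma coeff_P: "i > n \<Longrightarrow> coeff (P n) i = 0"
proof -
  have "degree (P n) \<le> n"
    unfolding P_def
  proof (rule degree_sum_le)
    fix s assume "s \<in> {..n}"
    have "degree ([:-1/2, 1/2::real:] ^ s * [:1/2, 1/2:] ^ (n - s)) \<le> 1 * s + 1 * (n - s)"
      by (intro order.trans[OF degree_mult_le] add_mono order.trans[OF degree_power_le]) auto
    with \<open>s \<in> {..n}\<close> show "degree (smult (((real n + a) gchoose (n - s)) * ((real n + b) gchoose s))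
            ([:-1/2, 1/2:] ^ s * [:1/2, 1/2:] ^ (n - s))) \<le> n"
      by simp
  qed simp
  then show "i > n \<Longrightarrow> coeff (P n) i = 0"
    by (simp add: coeff_eq_0)
qed

text \<open>At x = 1 only the term s = 0 survives, and a > -1 makes it positive.\<close>

lemma P_nonzero: "P n \<noteq> 0"
proof -
  have "poly (P n) 1 = (\<Sum>s\<le>n. if s = 0 then (real n + a) gchoose n else 0)"
    unfolding P_def poly_sum by (intro sum.cong) auto
  also have "\<dots> = (real n + a) gchoose n" by (subst sum.delta) auto
  also have "\<dots> = pochhammer (a + 1) n / fact n"
    by (simp add: gbinomial_pochhammer')
  also have "\<dots> > 0" using a by (simp add: pochhammer_pos)
  finally show ?thesis by auto
qed

lemma L_add: "L (p + q) = L p + L q"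
  unfolding L_def pderiv_add by algebra

lemma L_smult: "L (smult c p) = smult c (L p)"
  unfolding L_def pderiv_smult by (simp only: mult_smult_right smult_add_right smult_minus_right)

lemma L_0: "L 0 = 0" by (simp add: L_def)

lemma L_sum: "L (\<Sum>i\<in>I. p i) = (\<Sum>i\<in>I. L (p i))"
  by (induction I rule: infinite_finite_induct) (simp_all add: L_add L_0)

text \<open>In u and v the coefficients of \<open>L\<close> are the forms -4uv and -2((a + 1)v + (b
  + 1)u). Hence \<open>L\<close> preserves the total degree j + k and is tridiagonal on the
  monomials u^j v^k.\<close>

lemma poly_L_monomial:
  fixes j k :: nat and x :: real
  defines "u \<equiv> (x - 1) / 2" and "v \<equiv> (x + 1) / 2"
  shows "poly (L ([:-1/2, 1/2:] ^ j * [:1/2, 1/2:] ^ k)) x =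
    j * (j + a) * (u ^ (j - 1) * v ^ (k + 1))
    + (2 * j * k + (a + 1) * k + (b + 1) * j) * (u ^ j * v ^ k)
    + k * (k + b) * (u ^ (j + 1) * v ^ (k - 1))"
proof -
  define U V :: "real poly" where "U = [:-1/2, 1/2:]" and "V = [:1/2, 1/2:]"
  have dU: "pderiv U = [:1/2:]" and dV: "pderiv V = [:1/2:]"
    by (simp_all add: U_def V_def pderiv_pCons)
  have D: "pderiv (U ^ j * V ^ k) =
      smult (j / 2) (U ^ (j - 1) * V ^ k) + smult (k / 2) (U ^ j * V ^ (k - 1))" for j k
    by (simp add: pderiv_mult pderiv_power dU dV algebra_simps)
  have pU: "poly U x = u" and pV: "poly V x = v"
    by (simp_all add: U_def V_def u_def v_def field_simps)
  have w1: "poly [:1, 0, -1:] x = -4 * u * v"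
    by (simp add: u_def v_def field_simps)
  have w2: "poly [:b - a, -(a + b + 2):] x = - 2 * ((a + 1) * v + (b + 1) * u)"
    by (simp add: u_def v_def field_simps)
  have D1: "poly (pderiv (U ^ j * V ^ k)) x = j / 2 * (u ^ (j - 1) * v ^ k) + k / 2 * (u ^ j * v ^ (k - 1))"
    by (simp add: D pU pV)
  have D2: "poly (pderiv (pderiv (U ^ j * V ^ k))) x =
      j / 2 * (real (j - 1) / 2 * (u ^ (j - 2) * v ^ k) + k / 2 * (u ^ (j - 1) * v ^ (k - 1))) +
      k / 2 * (j / 2 * (u ^ (j - 1) * v ^ (k - 1)) + real (k - 1) / 2 * (u ^ j * v ^ (k - 2)))"
    unfolding D pderiv_add pderiv_smult
    by (simp only: poly_add poly_smult poly_mult poly_power pU pV diff_diff_left one_add_one)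
  \<comment> \<open>The prefactors i and i(i - 1) vanish exactly where truncated subtraction would
    give a wrong exponent.\<close>
  have e0: "i * (y * y ^ (i - 1)) = i * y ^ i" for i :: nat and y :: real
    by (cases i) simp_all
  have e2: "i * real (i - 1) * (y * y ^ (i - 2)) = i * (real i - 1) * y ^ (i - 1)" for i :: nat and y :: real
    using e0[of "i - 1" y] by (cases i) (simp_all add: mult.assoc numeral_2_eq_2)
  note e1 = e2[of j u] e2[of k v] e0[of j u] e0[of k v]
  have "poly (L (U ^ j * V ^ k)) x =
     4 * u * v * poly (pderiv (pderiv (U ^ j * V ^ k))) x
     + 2 * ((a + 1) * v + (b + 1) * u) * poly (pderiv (U ^ j * V ^ k)) x"
    unfolding L_def by (simp only: poly_minus poly_add poly_mult w1 w2)
  also have "\<dots> = (j * real (j - 1) * (u * u ^ (j - 2))) * (v * v ^ k)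
     + 2 * (j * (u * u ^ (j - 1))) * (k * (v * v ^ (k - 1)))
     + (u * u ^ j) * (k * real (k - 1) * (v * v ^ (k - 2)))
     + (a + 1) * j * (u ^ (j - 1) * (v * v ^ k)) + (a + 1) * u ^ j * (k * (v * v ^ (k - 1)))
     + (b + 1) * (j * (u * u ^ (j - 1))) * v ^ k + (b + 1) * k * (u * u ^ j * v ^ (k - 1))"
    unfolding D1 D2 by (simp add: algebra_simps add_divide_distrib)
  also have "\<dots> = j * (j + a) * (u ^ (j - 1) * v ^ (k + 1))
    + (2 * j * k + (a + 1) * k + (b + 1) * j) * (u ^ j * v ^ k)
    + k * (k + b) * (u ^ (j + 1) * v ^ (k - 1))"
    unfolding e1 by (simp add: algebra_simps)
  finally show ?thesis unfolding U_def V_def .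
qed

text \<open>The coefficient of u^s v^(n-s) in \<open>L (P n)\<close> receives terms from s - 1, s
  and s + 1. The ratio of consecutive coefficients of \<open>P n\<close> turns the neighbouring
  terms into multiples of \<open>c s\<close>, and the three multipliers add up to
  \<open>eig n\<close> for every s.\<close>

lemma L_P: "L (P n) = smult (eig n) (P n)"
proof -
  have "poly (L (P n)) x = poly (smult (eig n) (P n)) x" for x
  proof -
    define u v where "u = (x - 1) / 2" and "v = (x + 1) / 2"
    define c where "c s = ((real n + a) gchoose (n - s)) * ((real n + b) gchoose s)" for s
    define m where "m s = u ^ s * v ^ (n - s)" for s
    \<comment> \<open>Both binomial factors change by a known ratio when s grows by one; this
      two-term relation drives the index shifts \<open>up\<close> and \<open>down\<close>.\<close>
    have rec: "c (Suc s) * Suc s * (Suc s + a) = c s * (real n - s) * (real n - s + b)"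
      if "s < n" for s
    proof -
      define A1 A2 B1 B2 where "A1 = ((real n + a) gchoose (n - s))"
        and "A2 = ((real n + a) gchoose (n - Suc s))"
        and "B1 = ((real n + b) gchoose s)" and "B2 = ((real n + b) gchoose (Suc s))"
      have "Suc (n - Suc s) = n - s" using that by simp
      then have A: "(real n - s) * A1 = (a + Suc s) * A2"
        using gbinomial_Suc_mult[of "n - Suc s" "real n + a"] that
        by (simp add: A1_def A2_def of_nat_diff algebra_simps)
      have B: "Suc s * B2 = (real n + b - s) * B1"
        using gbinomial_Suc_mult[of s "real n + b"] by (simp add: B1_def B2_def)
      have "c (Suc s) * Suc s * (Suc s + a) = ((a + Suc s) * A2) * (Suc s * B2)"
        by (simp add: c_def A2_def B2_def)
      also have "\<dots> = c s * (real n - s) * (real n - s + b)"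
        unfolding A[symmetric] B by (simp add: c_def A1_def B1_def algebra_simps)
      finally show ?thesis .
    qed
    \<comment> \<open>The left summand vanishes at s = 0 and the right one at s = n, so shifting by
      one loses nothing.\<close>
    have up: "(\<Sum>s\<le>n. c s * (s * (s + a) * (u ^ (s - 1) * v ^ (n - s + 1)))) =
        (\<Sum>s\<le>n. c s * ((real n - s) * (real n - s + b)) * m s)" (is "sum ?f _ = sum ?g _")
    proof -
      have "sum ?f {..n} = (\<Sum>s<n. ?f (Suc s))"
        unfolding sum.atMost_shift by simp
      also have "\<dots> = (\<Sum>s<n. ?g s)"
      proof (intro sum.cong refl)
        fix s assume s: "s \<in> {..<n}"
        then have "n - Suc s + 1 = n - s" by simp
        then show "?f (Suc s) = ?g s"
          using rec[of s] s by (simp add: m_def mult.assoc[symmetric])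
      qed
      also have "\<dots> = sum ?g {..n}" by (simp add: lessThan_Suc_atMost[symmetric])
      finally show ?thesis .
    qed
    have down: "(\<Sum>s\<le>n. c s * (real (n - s) * (real (n - s) + b) * (u ^ (s + 1) * v ^ (n - s - 1)))) =
        (\<Sum>s\<le>n. c s * (s * (s + a)) * m s)" (is "sum ?f _ = sum ?g _")
    proof -
      have "sum ?f {..n} = (\<Sum>s<n. ?f s)" by (simp add: lessThan_Suc_atMost[symmetric])
      also have "\<dots> = (\<Sum>s<n. ?g (Suc s))"
      proof (intro sum.cong refl)
        fix s assume s: "s \<in> {..<n}"
        then show "?f s = ?g (Suc s)"
          using rec[of s] s by (simp add: m_def mult.assoc[symmetric] of_nat_diff)
      qed
      also have "\<dots> = sum ?g {..n}"
        unfolding sum.atMost_shift by simp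
      finally show ?thesis .
    qed
    have "poly (L (P n)) x = (\<Sum>s\<le>n. c s * poly (L ([:-1/2, 1/2:] ^ s * [:1/2, 1/2:] ^ (n - s))) x)"
      unfolding P_def L_sum L_smult poly_sum c_def by simp
    also have "\<dots> = (\<Sum>s\<le>n. c s * (s * (s + a) * (u ^ (s - 1) * v ^ (n - s + 1))))
       + (\<Sum>s\<le>n. c s * (2 * s * real (n - s) + (a + 1) * real (n - s) + (b + 1) * s) * m s)
       + (\<Sum>s\<le>n. c s * (real (n - s) * (real (n - s) + b) * (u ^ (s + 1) * v ^ (n - s - 1))))"
      unfolding poly_L_monomial u_def[symmetric] v_def[symmetric] sum.distrib[symmetric]
      by (intro sum.cong refl) (simp add: m_def algebra_simps)
    also have "\<dots> = (\<Sum>s\<le>n. eig n * (c s * m s))"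
      unfolding up down sum.distrib[symmetric]
      by (intro sum.cong refl) (simp add: eig_def of_nat_diff algebra_simps)
    also have "\<dots> = poly (smult (eig n) (P n)) x"
      by (simp add: poly_P jacobiP_def c_def m_def u_def v_def sum_distrib_left mult.assoc)
    finally show ?thesis .
  qed
  then show ?thesis by (simp add: poly_eq_poly_eq_iff[symmetric] fun_eq_iff)
qed

text \<open>Integration by parts for p' q. The right-hand side is symmetric in p and q, which makes
  \<open>L\<close> symmetric for \<open>E\<close>.\<close>

lemma E_L: "E (L p * q) = E ([:1, 0, -1:] * (pderiv p * pderiv q))"
proof -
  have "[:1, 0, -1:] * pderiv (pderiv p * q) + [:b - a, -(a + b + 2):] * (pderiv p * q)
      = [:1, 0, -1:] * (pderiv p * pderiv q) - L p * q"
    unfolding L_def pderiv_mult by algebra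
  then show ?thesis
    using E_by_parts[of "pderiv p * q"] by (simp add: E_diff)
qed

text \<open>Eigenvectors of a symmetric operator for distinct eigenvalues.\<close>

lemma E_P_orthogonal:
  assumes "j \<noteq> k"
  shows "E (P j * P k) = 0"
proof -
  have "eig j * E (P j * P k) = E (L (P j) * P k)"
    by (simp add: L_P E_smult)
  also have "\<dots> = E (L (P k) * P j)"
    unfolding E_L by (simp add: mult.commute)
  also have "\<dots> = eig k * E (P j * P k)"
    by (simp add: L_P E_smult mult.commute)
  finally have "(eig j - eig k) * E (P j * P k) = 0" by (simp add: algebra_simps)
  moreover have "eig j - eig k = (real j - real k) * (real j + real k + a + b + 1)"
    by (simp add: eig_def algebra_simps)
  \<comment> \<open>Distinct indices add up to at least 1, which compensates for a + b > -2 and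
    keeps the second factor positive.\<close>
  moreover have "real j + real k \<ge> 1" using assms by linarith
  then have "real j + real k + a + b + 1 > 0" using a b by linarith
  ultimately show ?thesis using assms by simp
qed

lemma E_P_pos: "0 < E (P n * P n)"
  by (rule E_square_pos[OF P_nonzero])

text \<open>The leading coefficient of \<open>P n\<close> is not computed: if it vanished, the
  induction hypothesis would put \<open>P n\<close> in the span of its predecessors, making it
  orthogonal to itself.\<close>

lemma P_spans:
  assumes "\<forall>i\<ge>n. coeff p i = 0"
  shows "\<exists>c. p = (\<Sum>k<n. smult (c k) (P k))"
  using assms
proof (induction n arbitrary: p)
  case 0
  then show ?case by (simp add: poly_eq_iff)
next
  case (Suc n)
  have "coeff (P n) n \<noteq> 0"
  proof
    assume "coeff (P n) n = 0"
    with coeff_P have "\<forall>i\<ge>n. coeff (P n) i = 0" by (metis le_neq_implies_less)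
    from Suc.IH[OF this] obtain c where c: "P n = (\<Sum>k<n. smult (c k) (P k))" by blast
    have "E (P n * P n) = E ((\<Sum>k<n. smult (c k) (P k)) * P n)" using c by simp
    also have "\<dots> = (\<Sum>k<n. c k * E (P k * P n))"
      by (simp add: sum_distrib_right E_sum E_smult)
    also have "\<dots> = 0" by (intro sum.neutral) (simp add: E_P_orthogonal)
    finally show False using E_P_pos[of n] by simp
  qed
  define d where "d = coeff p n / coeff (P n) n"
  have "coeff (p - smult d (P n)) i = 0" if "i \<ge> n" for i
    using that Suc.prems \<open>coeff (P n) n \<noteq> 0\<close> coeff_P[of n i]
    by (cases "i = n") (auto simp: d_def)
  then obtain c where c: "p - smult d (P n) = (\<Sum>k<n. smult (c k) (P k))"
    using Suc.IH by blast
  have "p = (\<Sum>k<Suc n. smult ((c(n := d)) k) (P k))"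
    using c by (simp add: algebra_simps)
  then show ?case by blast
qed

lemma E_expansion:
  "E ((\<Sum>k<n. smult (c k) (P k)) * (\<Sum>k<n. smult (d k) (P k)))
     = (\<Sum>k<n. c k * d k * E (P k * P k))"
proof -
  have "E ((\<Sum>k<n. smult (c k) (P k)) * (\<Sum>k<n. smult (d k) (P k)))
     = (\<Sum>j<n. \<Sum>k<n. c j * d k * E (P j * P k))"
    unfolding sum_product E_sum by (intro sum.cong refl) (simp add: E_smult)
  also have "\<dots> = (\<Sum>j<n. \<Sum>k<n. if k = j then c j * d j * E (P j * P j) else 0)"
    by (intro sum.cong refl) (auto simp: E_P_orthogonal)
  finally show ?thesis by simp
qed

text \<open>By \<open>E_L\<close> the left side is \<open>E (L p * p)\<close>, which is diagonal in
  the Jacobi basis, and the eigenvalues of index k < n are of order n^2. The absolute value covers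
  negative a + b + 1.\<close>

lemma bernstein_L2:
  assumes "\<forall>i\<ge>n. coeff p i = 0"
  shows "E ([:1, 0, -1:] * (pderiv p * pderiv p)) \<le> (1 + \<bar>a + b + 1\<bar>) * (real n)\<^sup>2 * E (p * p)"
proof -
  obtain c where c: "p = (\<Sum>k<n. smult (c k) (P k))"
    using P_spans[OF assms] by blast
  have "L p = (\<Sum>k<n. smult (c k * eig k) (P k))"
    by (simp add: c L_sum L_smult L_P)
  then have "E (L p * p) = (\<Sum>k<n. (c k * eig k) * c k * E (P k * P k))"
    unfolding c by (simp add: E_expansion)
  also have "\<dots> \<le> (\<Sum>k<n. (1 + \<bar>a + b + 1\<bar>) * (real n)\<^sup>2 * (c k * c k * E (P k * P k)))"
  proof (rule sum_mono)
    fix k assume k: "k \<in> {..<n}"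
    have "eig k \<le> real k * (real n + \<bar>a + b + 1\<bar> * real n)"
      unfolding eig_def
    proof (rule mult_left_mono)
      have "1 * \<bar>a + b + 1\<bar> \<le> real n * \<bar>a + b + 1\<bar>" using k by (intro mult_right_mono) auto
      then show "real k + a + b + 1 \<le> real n + \<bar>a + b + 1\<bar> * real n"
        using k by (auto simp: algebra_simps)
    qed simp
    also have "\<dots> \<le> real n * (real n + \<bar>a + b + 1\<bar> * real n)"
      using k by (intro mult_right_mono) auto
    finally have "eig k \<le> (1 + \<bar>a + b + 1\<bar>) * (real n)\<^sup>2"
      by (simp add: power2_eq_square algebra_simps)
    moreover have "0 \<le> c k * c k * E (P k * P k)" using E_P_pos[of k] by simp
    ultimately have "eig k * (c k * c k * E (P k * P k)) \<le>
        (1 + \<bar>a + b + 1\<bar>) * (real n)\<^sup>2 * (c k * c k * E (P k * P k))"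
      by (rule mult_right_mono)
    then show "(c k * eig k) * c k * E (P k * P k) \<le>
        (1 + \<bar>a + b + 1\<bar>) * (real n)\<^sup>2 * (c k * c k * E (P k * P k))"
      by (simp add: mult_ac)
  qed
  also have "\<dots> = (1 + \<bar>a + b + 1\<bar>) * (real n)\<^sup>2 * E (p * p)"
    unfolding c E_expansion by (simp add: sum_distrib_left)
  finally show ?thesis by (simp add: E_L)
qed

end

section \<open>Markov inequality in the weighted norm\<close>

text \<open>The Lagrange remainder contains the n-th derivative, which is zero.\<close>

lemma poly_taylor:
  fixes p :: "real poly"
  assumes "\<forall>i\<ge>n. coeff p i = 0"
  shows "poly p t = (\<Sum>k<n. poly ((pderiv ^^ k) p) s / fact k * (t - s) ^ k)"
proof -
  define D where "D k x = poly ((pderiv ^^ k) p) (s + x)" for k x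
  have "\<forall>k x. (D k has_real_derivative D (Suc k) x) (at x)"
    unfolding D_def by (auto intro!: derivative_eq_intros simp: add.commute)
  then obtain u where "D 0 (t - s) = (\<Sum>m<n. D m 0 / fact m * (t - s) ^ m) + D n u / fact n * (t - s) ^ n"
    using Maclaurin_all_le[of D "D 0" "t - s" n] by blast
  moreover have "(pderiv ^^ n) p = 0"
    using assms by (simp add: poly_eq_iff coeff_higher_pderiv)
  ultimately show ?thesis by (simp add: D_def)
qed

lemma weighted_sum_square_le:
  fixes w z :: "'i \<Rightarrow> real"
  assumes "\<And>k. k \<in> I \<Longrightarrow> 0 \<le> w k"
  shows "(\<Sum>k\<in>I. w k * z k)\<^sup>2 \<le> (\<Sum>k\<in>I. w k) * (\<Sum>k\<in>I. w k * (z k)\<^sup>2)"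
proof -
  have "(\<Sum>k\<in>I. w k * z k) = (\<Sum>k\<in>I. sqrt (w k) * (sqrt (w k) * z k))"
    using assms by (intro sum.cong refl) (simp add: mult.assoc[symmetric])
  moreover have "(\<Sum>k\<in>I. w k) = (\<Sum>k\<in>I. (sqrt (w k))\<^sup>2)"
    "(\<Sum>k\<in>I. w k * (z k)\<^sup>2) = (\<Sum>k\<in>I. (sqrt (w k) * z k)\<^sup>2)"
    using assms by (intro sum.cong refl; simp add: power_mult_distrib)+
  ultimately show ?thesis
    by (simp only: Cauchy_Schwarz_ineq_sum)
qed

context jacobi_weight
begin

definition bernstein_const :: real where
  "bernstein_const = 1 + \<bar>a + b + 1\<bar>"

definition edge_const :: real where
  "edge_const = 2 * min (a + 1) (b + 1)"

definition schur_const :: real where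
  "schur_const = 2 / edge_const * (a + b + 3 + 2 * bernstein_const / edge_const)"

lemma const_pos: "0 < bernstein_const" "0 < edge_const" "0 < schur_const"
proof -
  show *: "0 < bernstein_const" "0 < edge_const"
    using a b by (auto simp: bernstein_const_def edge_const_def)
  have "0 < a + b + 3" using a b by simp
  moreover have "0 < 2 * bernstein_const / edge_const" using * by simp
  ultimately have "0 < a + b + 3 + 2 * bernstein_const / edge_const" by (rule add_pos_pos)
  with * show "0 < schur_const" by (simp add: schur_const_def)
qed

text \<open>Testing integration by parts against \<open>x q\<^sup>2\<close> isolates the mass of
  \<open>q\<^sup>2\<close> near the endpoints: at \<open>x = 1\<close> and \<open>x = -1\<close>, the factor \<open>-x (b - a - (a + b + 2) x)\<close>
  is at least \<open>edge_const\<close>.\<close>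

lemma schur_L2:
  assumes q: "\<forall>i\<ge>n. coeff q i = 0"
  shows "E (q * q) \<le> schur_const * (real n)\<^sup>2 * E ([:1, 0, -1:] * (q * q))"
proof (cases "n = 0")
  case True
  with q have "q = 0" by (simp add: poly_eq_iff)
  then show ?thesis by simp
next
  case False
  define \<mu> where "\<mu> = edge_const"
  define \<Lambda> where "\<Lambda> = bernstein_const * (real n)\<^sup>2"
  \<comment> \<open>Young parameter for the mixed term 2 x q q'. It is chosen so that \<Lambda> / s
    = \<mu> / 2: after the Bernstein inequality for q, the derivative term costs half of the left
    side and can be absorbed.\<close>
  define s where "s = 2 * \<Lambda> / \<mu>"
  define A where "A = E ([:1, 0, -1:] * (q * q))"
  have pos: "0 < \<mu>" "0 < \<Lambda>" "0 < s"
    using const_pos False by (auto simp: \<mu>_def \<Lambda>_def s_def)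
  have A0: "0 \<le> A"
    unfolding A_def
  proof (rule E_nonneg)
    fix x :: real assume "x \<in> {-1<..<1}"
    then have "0 \<le> (1 - x\<^sup>2) * (poly q x)\<^sup>2"
      by (intro mult_nonneg_nonneg) (auto simp: abs_square_le_1)
    then show "0 \<le> poly ([:1, 0, -1:] * (q * q)) x"
      by (simp add: algebra_simps power2_eq_square)
  qed
  have "\<mu> * E (q * q) \<le> (a + b + 3) * A + s * A + 1 / s * E ([:1, 0, -1:] * (pderiv q * pderiv q))"
  proof -
    define r where "r = [:0, 1:] * (q * q)"
    define g where "g = [:1, 0, -1:] * pderiv r + [:b - a, -(a + b + 2):] * r"
    have "E (smult \<mu> (q * q) + g) \<le> E (smult (a + b + 3 + s) ([:1, 0, -1:] * (q * q))
        + smult (1 / s) ([:1, 0, -1:] * (pderiv q * pderiv q)))"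
    proof (rule E_mono)
      fix x :: real assume x: "x \<in> {-1<..<1}"
      define u v where "u = poly q x" and "v = poly (pderiv q) x"
      \<comment> \<open>The right side is affine with endpoint values 2(b + 1) and 2(a + 1), whose
        minimum is \<mu>.\<close>
      have "\<mu> \<le> (a + 1) * (1 + x) + (b + 1) * (1 - x)"
      proof -
        have "\<mu> = \<mu> / 2 * (1 + x) + \<mu> / 2 * (1 - x)" by (simp add: field_simps)
        also have "\<dots> \<le> (a + 1) * (1 + x) + (b + 1) * (1 - x)"
          using x by (intro add_mono mult_right_mono) (auto simp: \<mu>_def edge_const_def)
        finally show ?thesis .
      qed
      then have 1: "(\<mu> + (b - a - (a + b + 2) * x) * x) * u\<^sup>2 \<le> ((a + b + 2) * (1 - x\<^sup>2)) * u\<^sup>2"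
        by (intro mult_right_mono) (auto simp: algebra_simps power2_eq_square)
      have "x * (u * v) \<le> \<bar>x\<bar> * \<bar>u * v\<bar>"
        unfolding abs_mult[symmetric] by (rule abs_ge_self)
      also have "\<dots> \<le> 1 * \<bar>u * v\<bar>"
        using x by (intro mult_right_mono) auto
      finally have "2 * x * u * v \<le> 2 * \<bar>u * v\<bar>"
        by (simp add: mult.assoc)
      also have "\<dots> \<le> s * u\<^sup>2 + 1 / s * v\<^sup>2"
      proof -
        have "0 \<le> (s * \<bar>u\<bar> - \<bar>v\<bar>)\<^sup>2 / s" using pos by simp
        also have "\<dots> = s * u\<^sup>2 + 1 / s * v\<^sup>2 - 2 * \<bar>u * v\<bar>"
          using pos by (simp add: power2_diff field_simps abs_mult power2_eq_square)
        finally show ?thesis by simp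
      qed
      finally have 2: "(1 - x\<^sup>2) * (2 * x * u * v) \<le> (1 - x\<^sup>2) * (s * u\<^sup>2 + 1 / s * v\<^sup>2)"
        using x by (intro mult_left_mono) (auto simp: abs_square_le_1)
      have "poly (smult \<mu> (q * q) + g) x =
          (\<mu> + (b - a - (a + b + 2) * x) * x) * u\<^sup>2 + (1 - x\<^sup>2) * u\<^sup>2 + (1 - x\<^sup>2) * (2 * x * u * v)"
        by (simp add: g_def r_def u_def v_def pderiv_mult pderiv_pCons algebra_simps power2_eq_square)
      also have "\<dots> \<le> ((a + b + 2) * (1 - x\<^sup>2)) * u\<^sup>2 + (1 - x\<^sup>2) * u\<^sup>2
          + (1 - x\<^sup>2) * (s * u\<^sup>2 + 1 / s * v\<^sup>2)"
        using 1 2 by simp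
      also have "\<dots> = poly (smult (a + b + 3 + s) ([:1, 0, -1:] * (q * q))
        + smult (1 / s) ([:1, 0, -1:] * (pderiv q * pderiv q))) x"
        by (simp add: u_def v_def algebra_simps power2_eq_square diff_divide_distrib)
      finally show "poly (smult \<mu> (q * q) + g) x \<le> \<dots>" .
    qed
    moreover have "E g = 0" unfolding g_def by (rule E_by_parts)
    ultimately show ?thesis
      by (simp only: E_add E_smult A_def[symmetric] distrib_right)
  qed
  also have "1 / s * E ([:1, 0, -1:] * (pderiv q * pderiv q)) \<le> 1 / s * (\<Lambda> * E (q * q))"
    using bernstein_L2[OF q] pos
    by (intro mult_left_mono) (auto simp: \<Lambda>_def bernstein_const_def)
  also have "1 / s * (\<Lambda> * E (q * q)) = \<mu> / 2 * E (q * q)"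
    using pos by (simp add: s_def)
  finally have "\<mu> / 2 * E (q * q) \<le> (a + b + 3 + s) * A"
    by (simp add: algebra_simps)
  also have "\<dots> \<le> ((a + b + 3) * (real n)\<^sup>2 + s) * A"
  proof -
    have "(a + b + 3) * 1 \<le> (a + b + 3) * (real n)\<^sup>2"
      using a b False by (intro mult_left_mono) auto
    then show ?thesis using A0 by (intro mult_right_mono) auto
  qed
  finally have "E (q * q) \<le> 2 / \<mu> * (((a + b + 3) * (real n)\<^sup>2 + s) * A)"
    using pos by (simp add: field_simps)
  also have "\<dots> = schur_const * (real n)\<^sup>2 * A"
    using pos by (simp add: schur_const_def s_def \<Lambda>_def \<mu>_def[symmetric] field_simps)
  finally show ?thesis unfolding A_def .
qed

definition markov_const :: real where
  "markov_const = sqrt (schur_const * bernstein_const)"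

lemma markov_const_pos: "0 < markov_const"
  using const_pos by (simp add: markov_const_def)

text \<open>\<open>schur_L2\<close> for p' inserts the factor 1 - x^2 and
  \<open>bernstein_L2\<close> then removes the derivative; each costs a factor n^2.\<close>

lemma markov_L2:
  assumes p: "\<forall>i\<ge>n. coeff p i = 0"
  shows "E (pderiv p * pderiv p) \<le> (markov_const * (real n)\<^sup>2)\<^sup>2 * E (p * p)"
proof -
  have "\<forall>i\<ge>n. coeff (pderiv p) i = 0" using p by (simp add: coeff_pderiv)
  then have "E (pderiv p * pderiv p) \<le>
      schur_const * (real n)\<^sup>2 * E ([:1, 0, -1:] * (pderiv p * pderiv p))"
    by (rule schur_L2)
  also have "\<dots> \<le> schur_const * (real n)\<^sup>2 * (bernstein_const * (real n)\<^sup>2 * E (p * p))"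
    using bernstein_L2[OF p] const_pos
    by (intro mult_left_mono) (auto simp: bernstein_const_def)
  also have "\<dots> = (markov_const * (real n)\<^sup>2)\<^sup>2 * E (p * p)"
    using const_pos by (simp add: markov_const_def power_mult_distrib power2_eq_square)
  finally show ?thesis .
qed

text \<open>Derivatives still satisfy the degree bound n, so the same factor serves at every order;
  this geometric growth is what the factorials of the Taylor series later beat.\<close>

lemma markov_L2_higher:
  assumes p: "\<forall>i\<ge>n. coeff p i = 0"
  shows "E ((pderiv ^^ k) p * (pderiv ^^ k) p) \<le> (markov_const * (real n)\<^sup>2) ^ (2 * k) * E (p * p)"
proof (induction k)
  case (Suc k)
  have "\<forall>i\<ge>n. coeff ((pderiv ^^ k) p) i = 0" using p by (simp add: coeff_higher_pderiv)
  then have "E ((pderiv ^^ Suc k) p * (pderiv ^^ Suc k) p) \<le>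
      (markov_const * (real n)\<^sup>2)\<^sup>2 * E ((pderiv ^^ k) p * (pderiv ^^ k) p)"
    using markov_L2 by simp
  also have "\<dots> \<le> (markov_const * (real n)\<^sup>2)\<^sup>2 * ((markov_const * (real n)\<^sup>2) ^ (2 * k) * E (p * p))"
    by (intro mult_left_mono Suc.IH) simp
  finally show ?case by (simp add: power2_eq_square mult_ac)
qed simp

text \<open>The minorant must be a polynomial in s alone, valid for all t near s, so that it can be
  integrated across cells with different sample points. It is p^2 / (1 + \<theta>) minus a bound
  \<open>R\<close> for the squared Taylor remainder divided by \<theta>.\<close>

lemma nearby_values_minorant:
  assumes p: "\<forall>i\<ge>n. coeff p i = 0" and "0 < n" "0 < \<epsilon>" "0 < h"
    and h: "h * (markov_const * (real n)\<^sup>2) \<le> ln (1 + \<epsilon> / 2)"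
  shows "\<exists>G. (1 - \<epsilon>) * E (p * p) \<le> E G \<and> (\<forall>s t. \<bar>s - t\<bar> \<le> h \<longrightarrow> poly G s \<le> (poly p t)\<^sup>2)"
proof -
  define B where "B = markov_const * (real n)\<^sup>2"
  \<comment> \<open>One half of \<epsilon> pays for the factor 1 / (1 + \<theta>) \<ge> 1 -
    \<theta>, the other half for \<open>E R\<close>.\<close>
  define \<theta> where "\<theta> = \<epsilon> / 2"
  \<comment> \<open>Terms of the series of exp (h B): without k = 0 they add up to at most exp (h B)
    - 1 \<le> \<theta>. The powers of \<open>B\<close> are compensated in \<open>R\<close>, where
    \<open>d k\<close> divided by B^k has norm at most that of p.\<close>
  define w where "w k = (h * B) ^ k / fact k" for k
  define d where "d k = (pderiv ^^ k) p" for k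
  define R where "R = (\<Sum>k\<in>{1..<n}. smult (w k / B ^ (2 * k)) (d k * d k))"
  define G where "G = smult (1 / (1 + \<theta>)) (p * p) - R"
  have B: "0 < B" using markov_const_pos \<open>0 < n\<close> by (simp add: B_def)
  have \<theta>: "0 < \<theta>" using \<open>0 < \<epsilon>\<close> by (simp add: \<theta>_def)
  have w: "0 \<le> w k" for k using B \<open>0 < h\<close> by (simp add: w_def)
  have split: "{..<n} = insert 0 {1..<n}" using \<open>0 < n\<close> by auto
  have sum_w: "(\<Sum>k\<in>{1..<n}. w k) \<le> \<theta>"
  proof -
    have "(\<Sum>k\<in>{..<n}. w k) \<le> exp (h * B)"
    proof -
      have "w = (\<lambda>k. (h * B) ^ k /\<^sub>R fact k)" by (simp add: w_def fun_eq_iff divide_inverse mult.commute)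
      then show ?thesis
        unfolding exp_def using w summable_exp_generic[of "h * B"]
        by (metis finite_lessThan sum_le_suminf)
    qed
    also have "\<dots> \<le> exp (ln (1 + \<theta>))"
      using h by (simp add: B_def \<theta>_def)
    also have "\<dots> = 1 + \<theta>" using \<theta> by simp
    finally show ?thesis by (simp add: split w_def)
  qed
  have "E R \<le> (\<Sum>k\<in>{1..<n}. w k * E (p * p))"
    unfolding R_def E_sum E_smult
  proof (rule sum_mono)
    fix k
    have "w k / B ^ (2 * k) * E (d k * d k) \<le> w k / B ^ (2 * k) * (B ^ (2 * k) * E (p * p))"
      using markov_L2_higher[OF p, of k] w[of k] B
      by (intro mult_left_mono) (auto simp: d_def B_def)
    then show "w k / B ^ (2 * k) * E (d k * d k) \<le> w k * E (p * p)"
      using B by simp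
  qed
  also have "\<dots> \<le> \<theta> * E (p * p)"
    unfolding sum_distrib_right[symmetric] by (intro mult_right_mono sum_w E_square_nonneg)
  finally have ER: "E R \<le> \<theta> * E (p * p)" .
  have "1 - 2 * \<theta> \<le> 1 / (1 + \<theta>) - \<theta>"
  proof -
    have "(1 - \<theta>) * (1 + \<theta>) \<le> 1" by (simp add: algebra_simps)
    then have "1 - \<theta> \<le> 1 / (1 + \<theta>)" using \<theta> by (simp add: pos_le_divide_eq)
    then show ?thesis by simp
  qed
  then have "(1 - \<epsilon>) * E (p * p) \<le> (1 / (1 + \<theta>) - \<theta>) * E (p * p)"
    by (intro mult_right_mono E_square_nonneg) (simp add: \<theta>_def)
  also have "\<dots> \<le> E G"
    using ER by (simp add: G_def E_diff E_smult algebra_simps)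
  finally have EG: "(1 - \<epsilon>) * E (p * p) \<le> E G" .
  have "poly G s \<le> (poly p t)\<^sup>2" if st: "\<bar>s - t\<bar> \<le> h" for s t
  proof -
    define x y where "x = poly p s" and "y = poly p t"
    have "y - x = (\<Sum>k\<in>{1..<n}. poly (d k) s / fact k * (t - s) ^ k)"
      unfolding y_def x_def poly_taylor[OF p, of t s] split by (simp add: d_def)
    also have "\<bar>\<dots>\<bar> \<le> (\<Sum>k\<in>{1..<n}. w k * (\<bar>poly (d k) s\<bar> / B ^ k))"
    proof (rule order.trans[OF sum_abs], rule sum_mono)
      fix k
      have "\<bar>poly (d k) s / fact k * (t - s) ^ k\<bar> \<le> \<bar>poly (d k) s\<bar> / fact k * h ^ k"
        unfolding abs_mult power_abs abs_divide using st
        by (intro mult_mono power_mono) auto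
      also have "\<dots> = w k * (\<bar>poly (d k) s\<bar> / B ^ k)"
        using B by (simp add: w_def power_mult_distrib)
      finally show "\<bar>poly (d k) s / fact k * (t - s) ^ k\<bar> \<le> w k * (\<bar>poly (d k) s\<bar> / B ^ k)" .
    qed
    finally have "(y - x)\<^sup>2 \<le> (\<Sum>k\<in>{1..<n}. w k * (\<bar>poly (d k) s\<bar> / B ^ k))\<^sup>2"
      by (metis abs_ge_zero power2_abs power_mono)
    also have "\<dots> \<le> (\<Sum>k\<in>{1..<n}. w k) * (\<Sum>k\<in>{1..<n}. w k * (\<bar>poly (d k) s\<bar> / B ^ k)\<^sup>2)"
      by (rule weighted_sum_square_le) (rule w)
    also have "\<dots> \<le> \<theta> * (\<Sum>k\<in>{1..<n}. w k * (\<bar>poly (d k) s\<bar> / B ^ k)\<^sup>2)"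
      by (intro mult_right_mono sum_w sum_nonneg mult_nonneg_nonneg w) simp
    also have "(\<Sum>k\<in>{1..<n}. w k * (\<bar>poly (d k) s\<bar> / B ^ k)\<^sup>2) = poly R s"
      unfolding R_def poly_sum power_even_eq
      by (intro sum.cong refl) (simp add: power_divide power2_eq_square)
    finally have yx: "(y - x)\<^sup>2 \<le> \<theta> * poly R s" .
    \<comment> \<open>Young's inequality for x = y - (y - x). As (1 + 1/\<theta>) \<theta> = 1 +
      \<theta>, inserting \<open>yx\<close> gives both terms the same factor.\<close>
    have "x\<^sup>2 \<le> (1 + \<theta>) * y\<^sup>2 + (1 + 1 / \<theta>) * (y - x)\<^sup>2"
    proof -
      have "0 \<le> (\<theta> * y + (y - x))\<^sup>2 / \<theta>" using \<theta> by simp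
      also have "\<dots> = (1 + \<theta>) * y\<^sup>2 + (1 + 1 / \<theta>) * (y - x)\<^sup>2 - x\<^sup>2"
        using \<theta> by (simp add: power2_eq_square field_simps)
      finally show ?thesis by simp
    qed
    also have "\<dots> \<le> (1 + \<theta>) * y\<^sup>2 + (1 + 1 / \<theta>) * (\<theta> * poly R s)"
      using yx \<theta> by (intro add_left_mono mult_left_mono) auto
    also have "\<dots> = (1 + \<theta>) * (y\<^sup>2 + poly R s)"
      using \<theta> by (simp add: field_simps)
    finally have "x\<^sup>2 / (1 + \<theta>) \<le> y\<^sup>2 + poly R s"
      using \<theta> by (simp add: divide_le_eq mult.commute)
    then show ?thesis
      by (simp add: G_def x_def y_def power2_eq_square)
  qed
  with EG show ?thesis by blast
qed

end

section \<open>Finite-dimensional least squares\<close>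

lemma cmod_diff_square:
  "(cmod (u - v))\<^sup>2 = (cmod u)\<^sup>2 + (cmod v)\<^sup>2 - 2 * Re (v * cnj u)"
  unfolding cmod_power2 by (simp add: power2_eq_square algebra_simps)

text \<open>Gram--Schmidt: the \<open>M\<close>-th column is first projected off the previous ones; if nothing
  remains of it, the coefficient \<open>lam\<close> below is \<open>x / 0 = 0\<close>.\<close>

lemma ex_orthogonal_residual:
  fixes A :: "nat \<Rightarrow> nat \<Rightarrow> complex" and y :: "nat \<Rightarrow> complex" and M N :: nat
  shows "\<exists>z. (\<forall>i\<ge>M. z i = 0) \<and>
    (\<forall>i<M. (\<Sum>n<N. (y n - (\<Sum>j<M. A n j * z j)) * cnj (A n i)) = 0)"
proof (induction M arbitrary: y)
  case 0
  show ?case by (intro exI[of _ "\<lambda>_. 0"]) simp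
next
  case (Suc M)
  obtain z where z: "\<And>i. i < M \<Longrightarrow> (\<Sum>n<N. (y n - (\<Sum>j<M. A n j * z j)) * cnj (A n i)) = 0"
    using Suc.IH[of y] by blast
  \<comment> \<open>The induction hypothesis holds for any right-hand side, in particular for column
    M itself.\<close>
  obtain u where u: "\<And>i. i < M \<Longrightarrow> (\<Sum>n<N. (A n M - (\<Sum>j<M. A n j * u j)) * cnj (A n i)) = 0"
    using Suc.IH[of "\<lambda>n. A n M"] by blast
  define ry where "ry n = y n - (\<Sum>j<M. A n j * z j)" for n
  define r where "r n = A n M - (\<Sum>j<M. A n j * u j)" for n
  define lam where "lam = (\<Sum>n<N. ry n * cnj (r n)) / (\<Sum>n<N. r n * cnj (r n))"
  define z' where "z' j = (if j < M then z j - lam * u j else if j = M then lam else 0)" for j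
  have res: "y n - (\<Sum>j<Suc M. A n j * z' j) = ry n - lam * r n" for n
    by (simp add: z'_def ry_def r_def algebra_simps sum_subtractf sum_distrib_left)
  have orth: "(\<Sum>n<N. (ry n - lam * r n) * cnj (A n i)) = 0" if "i < M" for i
  proof -
    have "(\<Sum>n<N. (ry n - lam * r n) * cnj (A n i)) =
        (\<Sum>n<N. ry n * cnj (A n i)) - lam * (\<Sum>n<N. r n * cnj (A n i))"
      by (simp add: algebra_simps sum_subtractf sum_distrib_left)
    then show ?thesis using z[OF that] u[OF that] by (simp add: ry_def r_def)
  qed
  have "(\<Sum>n<N. (ry n - lam * r n) * cnj (r n)) = 0"
  proof -
    have D: "(\<Sum>n<N. r n * cnj (r n)) = complex_of_real (\<Sum>n<N. (cmod (r n))\<^sup>2)"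
      by (simp add: complex_norm_square del: of_real_power)
    have "(\<Sum>n<N. ry n * cnj (r n)) = 0" if "(\<Sum>n<N. r n * cnj (r n)) = 0"
    proof -
      have "(\<Sum>n<N. (cmod (r n))\<^sup>2) = 0" using that unfolding D of_real_eq_0_iff .
      then have "\<forall>n\<in>{..<N}. r n = 0" by (subst (asm) sum_nonneg_eq_0_iff) auto
      then show ?thesis by simp
    qed
    then have "(\<Sum>n<N. ry n * cnj (r n)) = lam * (\<Sum>n<N. r n * cnj (r n))"
      by (auto simp: lam_def)
    then show ?thesis by (simp add: algebra_simps sum_subtractf sum_distrib_left)
  qed
  \<comment> \<open>Column M is \<open>r\<close> plus a combination of earlier columns, so
    orthogonality to those suffices.\<close>
  moreover have "(\<Sum>n<N. (ry n - lam * r n) * cnj (A n M)) =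
      (\<Sum>n<N. (ry n - lam * r n) * cnj (r n)) +
      (\<Sum>j<M. cnj (u j) * (\<Sum>n<N. (ry n - lam * r n) * cnj (A n j)))"
  proof -
    have "(\<Sum>j<M. cnj (u j) * (\<Sum>n<N. (ry n - lam * r n) * cnj (A n j))) =
        (\<Sum>n<N. (ry n - lam * r n) * cnj (\<Sum>j<M. A n j * u j))"
      unfolding sum_distrib_left cnj_sum by (subst sum.swap) (simp add: mult_ac)
    then show ?thesis by (simp add: r_def algebra_simps sum.distrib[symmetric])
  qed
  ultimately have "(\<Sum>n<N. (ry n - lam * r n) * cnj (A n M)) = 0"
    using orth by simp
  with orth have "\<forall>i<Suc M. (\<Sum>n<N. (y n - (\<Sum>j<Suc M. A n j * z' j)) * cnj (A n i)) = 0"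
    unfolding res by (auto simp: less_Suc_eq)
  moreover have "\<forall>i\<ge>Suc M. z' i = 0" by (simp add: z'_def)
  ultimately show ?case by blast
qed

text \<open>Orthogonality of the residual gives Pythagoras: \<open>res z\<close> is
  \<open>res xc\<close> plus the squared norm of A (z - xc). Coercivity then yields minimality,
  uniqueness and, after dropping \<open>res xc\<close> \<ge> 0, the stability bound.\<close>

lemma least_squares:
  fixes A :: "nat \<Rightarrow> nat \<Rightarrow> complex" and y :: "nat \<Rightarrow> complex" and M N :: nat and \<kappa> :: real
  defines "res \<equiv> \<lambda>z. \<Sum>n<N. (cmod ((\<Sum>i<M. A n i * z i) - y n))\<^sup>2"
  assumes \<kappa>: "0 < \<kappa>"
    and coercive: "\<And>z. \<kappa> * (\<Sum>i<M. (cmod (z i))\<^sup>2) \<le> (\<Sum>n<N. (cmod (\<Sum>i<M. A n i * z i))\<^sup>2)"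
  obtains xc where "\<And>i. i \<ge> M \<Longrightarrow> xc i = 0"
    "\<And>z. res xc \<le> res z"
    "\<And>z. res z \<le> res xc \<Longrightarrow> (\<forall>i\<ge>M. z i = 0) \<Longrightarrow> z = xc"
    "\<And>z. \<kappa> * (\<Sum>i<M. (cmod (z i - xc i))\<^sup>2) \<le> res z"
proof -
  obtain xc where xc0: "\<And>i. i \<ge> M \<Longrightarrow> xc i = 0" and
    xc: "\<And>i. i < M \<Longrightarrow> (\<Sum>n<N. (y n - (\<Sum>j<M. A n j * xc j)) * cnj (A n i)) = 0"
    using ex_orthogonal_residual[where A = A and y = y and M = M and N = N] by blast
  have pyth: "res z = (\<Sum>n<N. (cmod (\<Sum>i<M. A n i * (z i - xc i)))\<^sup>2) + res xc" for z
  proof -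
    define r where "r n = y n - (\<Sum>j<M. A n j * xc j)" for n
    define v where "v n = (\<Sum>i<M. A n i * (z i - xc i))" for n
    have "(\<Sum>n<N. r n * cnj (v n)) = (\<Sum>i<M. cnj (z i - xc i) * (\<Sum>n<N. r n * cnj (A n i)))"
      unfolding v_def cnj_sum sum_distrib_left by (subst sum.swap) (simp add: mult_ac)
    also have "\<dots> = 0" using xc by (simp add: r_def)
    finally have "(\<Sum>n<N. Re (r n * cnj (v n))) = 0"
      by (metis Re_sum zero_complex.sel(1))
    moreover have "(\<Sum>i<M. A n i * z i) - y n = v n - r n" for n
      by (simp add: v_def r_def algebra_simps sum_subtractf)
    then have "res z = (\<Sum>n<N. (cmod (v n))\<^sup>2 + (cmod (r n))\<^sup>2 - 2 * Re (r n * cnj (v n)))"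
      unfolding res_def by (simp only: cmod_diff_square)
    moreover have "res xc = (\<Sum>n<N. (cmod (r n))\<^sup>2)"
      unfolding res_def r_def by (simp add: norm_minus_commute)
    ultimately show ?thesis
      by (simp add: sum.distrib sum_subtractf sum_distrib_left[symmetric] v_def)
  qed
  have below: "\<kappa> * (\<Sum>i<M. (cmod (z i - xc i))\<^sup>2) \<le> res z - res xc" for z
    using coercive[of "\<lambda>i. z i - xc i"] pyth[of z] by simp
  have nn: "0 \<le> \<kappa> * (\<Sum>i<M. (cmod (z i - xc i))\<^sup>2)" for z
    using \<kappa> by (intro mult_nonneg_nonneg sum_nonneg) auto
  show thesis
  proof (rule that[OF xc0])
    show "res xc \<le> res z" for z using below[of z] nn[of z] by simp
    have "0 \<le> res xc" unfolding res_def by (intro sum_nonneg) simp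
    then show "\<kappa> * (\<Sum>i<M. (cmod (z i - xc i))\<^sup>2) \<le> res z" for z
      using below[of z] by simp
    show "z = xc" if "res z \<le> res xc" "\<forall>i\<ge>M. z i = 0" for z
    proof
      fix i
      have "\<kappa> * (\<Sum>i<M. (cmod (z i - xc i))\<^sup>2) \<le> 0" using below[of z] that by simp
      then have "(\<Sum>i<M. (cmod (z i - xc i))\<^sup>2) \<le> 0" using \<kappa> by (simp add: mult_le_0_iff)
      moreover have "0 \<le> (\<Sum>i<M. (cmod (z i - xc i))\<^sup>2)" by (intro sum_nonneg) simp
      ultimately have "(\<Sum>i<M. (cmod (z i - xc i))\<^sup>2) = 0" by linarith
      then have "\<forall>i<M. z i = xc i" by (subst (asm) sum_nonneg_eq_0_iff) auto
      then show "z i = xc i" using that xc0 by (cases "i < M") auto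
    qed
  qed
qed

section \<open>Voronoi quadrature\<close>

lemma set_integral_sum:
  fixes f :: "'i \<Rightarrow> 'a \<Rightarrow> real"
  assumes "\<And>i. i \<in> I \<Longrightarrow> set_integrable M A (f i)"
  shows "set_integrable M A (\<lambda>x. \<Sum>i\<in>I. f i x)"
    and "(LINT x:A|M. (\<Sum>i\<in>I. f i x)) = (\<Sum>i\<in>I. LINT x:A|M. f i x)"
  using assms unfolding set_integrable_def set_lebesgue_integral_def
  by (simp_all add: sum_distrib_left)

lemma voronoi_cell_sets [measurable]: "voronoi_cell N t n \<in> sets borel"
proof -
  have "voronoi_cell N t n = {-1<..<1} \<inter> (\<Inter>m\<in>{..<N} - {n}. {s. \<bar>s - t n\<bar> \<le> \<bar>s - t m\<bar>})"
    by (auto simp: voronoi_cell_def)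
  moreover have "closed (\<Inter>m\<in>{..<N} - {n}. {s. \<bar>s - t n\<bar> \<le> \<bar>s - t m\<bar>})"
    by (intro closed_INT ballI closed_Collect_le continuous_intros)
  ultimately show ?thesis by simp
qed

lemma voronoi_cell_subset: "voronoi_cell N t n \<subseteq> {-1<..<1}"
  by (auto simp: voronoi_cell_def)

lemma voronoi_cell_dist:
  assumes "n < N" "\<And>n. n < N \<Longrightarrow> t n \<in> {-1..1}" "s \<in> voronoi_cell N t n"
  shows "\<bar>s - t n\<bar> \<le> point_density N t"
proof -
  have s: "s \<in> {-1<..<1}" using assms(3) by (simp add: voronoi_cell_def)
  have "Min ((\<lambda>n. \<bar>s - t n\<bar>) ` {..<N}) = \<bar>s - t n\<bar>"
    using assms by (intro Min_eqI) (auto simp: voronoi_cell_def)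
  moreover have "Min ((\<lambda>n. \<bar>s - t n\<bar>) ` {..<N}) \<le> point_density N t"
    unfolding point_density_def
  proof (rule cSUP_upper[OF s])
    \<comment> \<open>Boundedness makes the real supremum meaningful; 2 is the diameter of
      [-1,1].\<close>
    show "bdd_above ((\<lambda>s. Min ((\<lambda>n. \<bar>s - t n\<bar>) ` {..<N})) ` {-1<..<1})"
    proof (rule bdd_aboveI2)
      fix x :: real assume "x \<in> {-1<..<1}"
      then have "\<bar>x - t n\<bar> \<le> 2" using assms(2)[OF \<open>n < N\<close>] by auto
      moreover have "Min ((\<lambda>n. \<bar>x - t n\<bar>) ` {..<N}) \<le> \<bar>x - t n\<bar>"
        using \<open>n < N\<close> by (intro Min_le) auto
      ultimately show "Min ((\<lambda>n. \<bar>x - t n\<bar>) ` {..<N}) \<le> 2" by simp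
    qed
  qed
  ultimately show ?thesis by simp
qed

text \<open>Distinct sample points tie only at a midpoint of two of them, and there are finitely
  many midpoints.\<close>

lemma AE_unique_voronoi_cell:
  assumes "0 < N" and inj: "inj_on t {..<N}"
  shows "AE s in lborel. s \<in> {-1<..<1} \<longrightarrow>
    (\<exists>n<N. s \<in> voronoi_cell N t n \<and> (\<forall>m<N. s \<in> voronoi_cell N t m \<longrightarrow> m = n))"
proof -
  define Z where "Z = (\<lambda>(m, n). (t m + t n) / 2) ` ({..<N} \<times> {..<N})"
  have "finite Z" by (simp add: Z_def)
  then have "AE s in lborel. s \<notin> Z"
    by (intro AE_not_in finite_imp_null_set_lborel)
  then show ?thesis
  proof (rule AE_mp, intro AE_I2 impI)
    fix s assume s: "s \<notin> Z" "s \<in> {-1<..<1}"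
    have "Min ((\<lambda>n. \<bar>s - t n\<bar>) ` {..<N}) \<in> (\<lambda>n. \<bar>s - t n\<bar>) ` {..<N}"
      using \<open>0 < N\<close> by (intro Min_in) auto
    then obtain n where n: "n < N" "Min ((\<lambda>n. \<bar>s - t n\<bar>) ` {..<N}) = \<bar>s - t n\<bar>" by auto
    have "\<bar>s - t n\<bar> \<le> \<bar>s - t m\<bar>" if "m < N" for m
      unfolding n(2)[symmetric] using that by (intro Min_le) auto
    then have "s \<in> voronoi_cell N t n" using s by (auto simp: voronoi_cell_def)
    moreover have "m = n" if m: "m < N" "s \<in> voronoi_cell N t m" for m
    proof (rule ccontr)
      assume "m \<noteq> n"
      then have "\<bar>s - t m\<bar> = \<bar>s - t n\<bar>"
        using m n \<open>s \<in> voronoi_cell N t n\<close> by (auto simp: voronoi_cell_def intro: antisym)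
      moreover have "t m \<noteq> t n" using inj m n \<open>m \<noteq> n\<close> by (auto simp: inj_on_def)
      ultimately have "s = (t m + t n) / 2" by (auto simp: abs_if field_simps split: if_splits)
      then have "s \<in> Z" unfolding Z_def using m n by (intro image_eqI[of _ _ "(m, n)"]) auto
      then show False using s by simp
    qed
    ultimately show "\<exists>n<N. s \<in> voronoi_cell N t n \<and> (\<forall>m<N. s \<in> voronoi_cell N t m \<longrightarrow> m = n)"
      using n by blast
  qed
qed

lemma sum_cells_eq:
  fixes y :: "nat \<Rightarrow> real"
  assumes "n < N" "s \<in> voronoi_cell N t n" "\<And>m. m < N \<Longrightarrow> s \<in> voronoi_cell N t m \<Longrightarrow> m = n"
  shows "(\<Sum>m<N. indicator (voronoi_cell N t m) s * y m) = y n"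
proof -
  have "(\<Sum>m<N. indicator (voronoi_cell N t m) s * y m) = (\<Sum>m<N. if m = n then y n else 0)"
  proof (intro sum.cong refl)
    fix m assume "m \<in> {..<N}"
    then have "s \<in> voronoi_cell N t m \<longleftrightarrow> m = n" using assms(2,3) by blast
    then show "indicator (voronoi_cell N t m) s * y m = (if m = n then y n else 0)"
      by (simp add: indicator_def)
  qed
  then show ?thesis using \<open>n < N\<close> by simp
qed

context jacobi_weight
begin

lemma set_integrable_nu: "set_integrable lborel {-1<..<1} (jacobi_nu a b)"
  using set_integrable_poly_nu[of 1] by simp

lemma quad_weight_nonneg: "0 \<le> quad_weight a b N t n"
  unfolding quad_weight_def using nu_nonneg by (intro set_integral_nonneg) auto

lemma set_integrable_cell:
  "set_integrable lborel {-1<..<1} (\<lambda>s. indicator (voronoi_cell N t n) s * y * jacobi_nu a b s)"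
proof (rule set_integrable_bound)
  show "set_integrable lborel {-1<..<1} (\<lambda>s. y * jacobi_nu a b s)"
    by (intro set_integrable_mult_right set_integrable_nu)
  show "set_borel_measurable lborel {-1<..<1} (\<lambda>s. indicator (voronoi_cell N t n) s * y * jacobi_nu a b s)"
    unfolding set_borel_measurable_def by measurable
qed (auto simp: indicator_def)

lemma quad_sum_eq:
  "(\<Sum>n<N. quad_weight a b N t n * y n) =
    (LINT s:{-1<..<1}|lborel. (\<Sum>n<N. indicator (voronoi_cell N t n) s * y n) * jacobi_nu a b s)"
proof -
  have "quad_weight a b N t n * y n =
      (LINT s:{-1<..<1}|lborel. indicator (voronoi_cell N t n) s * y n * jacobi_nu a b s)" for n
  proof -
    have "(LINT s:{-1<..<1}|lborel. indicator (voronoi_cell N t n) s * y n * jacobi_nu a b s) =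
        (LINT s:{-1<..<1}|lborel. y n * (indicator (voronoi_cell N t n) s * jacobi_nu a b s))"
      by (simp add: mult_ac)
    also have "\<dots> = y n * (LINT s:{-1<..<1}|lborel. indicator (voronoi_cell N t n) s * jacobi_nu a b s)"
      by simp
    also have "(LINT s:{-1<..<1}|lborel. indicator (voronoi_cell N t n) s * jacobi_nu a b s)
        = quad_weight a b N t n"
      unfolding quad_weight_def set_lebesgue_integral_def
      using voronoi_cell_subset[of N t n]
      by (intro Bochner_Integration.integral_cong refl) (auto simp: indicator_def)
    finally show ?thesis by simp
  qed
  then show ?thesis
    unfolding sum_distrib_right by (subst set_integral_sum(2)) (simp_all add: set_integrable_cell)
qed

text \<open>The quadrature sum is the integral of a step function. Since almost every point lies in
  exactly one cell, a bound on each cell is a bound almost everywhere.\<close>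

lemma quad_sum_ge:
  assumes "0 < N" "inj_on t {..<N}"
    and ge: "\<And>s n. n < N \<Longrightarrow> s \<in> voronoi_cell N t n \<Longrightarrow> poly G s \<le> y n"
  shows "E G \<le> (\<Sum>n<N. quad_weight a b N t n * y n)"
  unfolding quad_sum_eq E_def
proof (rule set_integral_mono_AE)
  show "set_integrable lborel {-1<..<1}
      (\<lambda>s. (\<Sum>n<N. indicator (voronoi_cell N t n) s * y n) * jacobi_nu a b s)"
    unfolding sum_distrib_right by (intro set_integral_sum(1) set_integrable_cell)
  show "AE s\<in>{-1<..<1} in lborel. poly G s * jacobi_nu a b s
      \<le> (\<Sum>n<N. indicator (voronoi_cell N t n) s * y n) * jacobi_nu a b s"
    using AE_unique_voronoi_cell[OF assms(1,2)]
  proof eventually_elim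
    case (elim s)
    show ?case
    proof
      assume "s \<in> {-1<..<1}"
      with elim obtain n where n: "n < N" "s \<in> voronoi_cell N t n"
        "\<And>m. m < N \<Longrightarrow> s \<in> voronoi_cell N t m \<Longrightarrow> m = n" by blast
      have "(\<Sum>n<N. indicator (voronoi_cell N t n) s * y n) = y n"
        using n by (rule sum_cells_eq)
      then show "poly G s * jacobi_nu a b s
          \<le> (\<Sum>n<N. indicator (voronoi_cell N t n) s * y n) * jacobi_nu a b s"
        using ge[OF n(1,2)] nu_nonneg by (simp add: mult_right_mono)
    qed
  qed
qed (rule set_integrable_poly_nu)

lemma sum_quad_weight_le:
  assumes "0 < N" "inj_on t {..<N}"
  shows "(\<Sum>n<N. quad_weight a b N t n) \<le> 1"
  \<comment> \<open>The constant -1 turns the lower bound for quadrature sums into an upper bound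
    for the total weight.\<close>
  using quad_sum_ge[OF assms, of "-1" "\<lambda>_. -1"] by (simp add: E_minus E_one sum_negf)

text \<open>Lower Marcinkiewicz-Zygmund inequality: each point of a cell lies within the density of
  its sample point, where the minorant \<open>G\<close> applies.\<close>

lemma quad_sum_lower:
  assumes p: "\<forall>i\<ge>M. coeff p i = 0" and "0 < \<epsilon>" "0 < N" "inj_on t {..<N}"
    and t: "\<And>n. n < N \<Longrightarrow> t n \<in> {-1..1}"
    and density: "point_density N t \<le> ln (1 + \<epsilon> / 2) / markov_const / (real M)\<^sup>2"
  shows "(1 - \<epsilon>) * E (p * p) \<le> (\<Sum>n<N. quad_weight a b N t n * (poly p (t n))\<^sup>2)"
\<comment> \<open>For M = 0 the radius is a quotient by zero, hence 0, and the minorant needs h > 0;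
  but then p = 0.\<close>
proof (cases "M = 0")
  case True
  with p have "p = 0" by (simp add: poly_eq_iff)
  then show ?thesis by simp
next
  case False
  define h where "h = ln (1 + \<epsilon> / 2) / markov_const / (real M)\<^sup>2"
  have "0 < h" "h * (markov_const * (real M)\<^sup>2) \<le> ln (1 + \<epsilon> / 2)"
    using False markov_const_pos \<open>0 < \<epsilon>\<close> by (simp_all add: h_def)
  with nearby_values_minorant[OF p _ \<open>0 < \<epsilon>\<close>] False
  obtain G where G: "(1 - \<epsilon>) * E (p * p) \<le> E G"
    "\<And>s t. \<bar>s - t\<bar> \<le> h \<Longrightarrow> poly G s \<le> (poly p t)\<^sup>2" by blast
  have "E G \<le> (\<Sum>n<N. quad_weight a b N t n * (poly p (t n))\<^sup>2)"
    using assms(3,4) voronoi_cell_dist[OF _ t] density G(2)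
    by (intro quad_sum_ge) (force simp: h_def)+
  with G(1) show ?thesis by linarith
qed

section \<open>Orthonormal Jacobi basis and the sampling matrix\<close>

definition phi_poly :: "nat \<Rightarrow> real poly" where
  "phi_poly i = smult (1 / sqrt (E (P i * P i))) (P i)"

lemma poly_phi_poly: "poly (phi_poly i) x = jacobi_phi a b i x"
proof -
  have "E (P i * P i) = (LINT u:{-1<..<1}|lborel. jacobi_nu a b u * (jacobiP a b i u)\<^sup>2)"
    by (simp add: E_def poly_P power2_eq_square mult_ac)
  then show ?thesis by (simp add: phi_poly_def jacobi_phi_def poly_P)
qed

lemma coeff_phi_poly: "i < j \<Longrightarrow> coeff (phi_poly i) j = 0"
  by (simp add: phi_poly_def coeff_P)

lemma E_phi_expansion:
  fixes c :: "nat \<Rightarrow> real" and M :: nat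
  defines "p \<equiv> \<Sum>i<M. smult (c i) (phi_poly i)"
  shows "E (p * p) = (\<Sum>i<M. (c i)\<^sup>2)"
proof -
  have "p = (\<Sum>i<M. smult (c i / sqrt (E (P i * P i))) (P i))"
    by (simp add: p_def phi_poly_def)
  then have "E (p * p) = (\<Sum>i<M. c i / sqrt (E (P i * P i)) * (c i / sqrt (E (P i * P i))) * E (P i * P i))"
    by (simp only: E_expansion)
  also have "\<dots> = (\<Sum>i<M. (c i)\<^sup>2)"
  proof (intro sum.cong refl)
    fix i
    show "c i / sqrt (E (P i * P i)) * (c i / sqrt (E (P i * P i))) * E (P i * P i) = (c i)\<^sup>2"
      using E_P_pos[of i] by (simp add: power2_eq_square)
  qed
  finally show ?thesis .
qed

lemma bdd_above_phi: "bdd_above ((\<lambda>s. \<bar>jacobi_phi a b i s\<bar>) ` {-1<..<1})"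
proof -
  have "compact ((\<lambda>s. \<bar>jacobi_phi a b i s\<bar>) ` {-1..1})"
    unfolding poly_phi_poly[symmetric]
    by (intro compact_continuous_image continuous_intros) auto
  then have "bdd_above ((\<lambda>s. \<bar>jacobi_phi a b i s\<bar>) ` {-1..1})"
    by (intro bounded_imp_bdd_above compact_imp_bounded)
  then show ?thesis by (rule bdd_above_mono) auto
qed

text \<open>Sample points may be endpoints while the supremum runs over the open interval;
  continuity extends the bound to the closure.\<close>

lemma abs_phi_le_SUP:
  assumes "x \<in> {-1..1}"
  shows "\<bar>jacobi_phi a b i x\<bar> \<le> (SUP s\<in>{-1<..<1}. \<bar>jacobi_phi a b i s\<bar>)"
proof -
  have "\<bar>poly (phi_poly i) x\<bar> \<le> (SUP s\<in>{-1<..<1}. \<bar>jacobi_phi a b i s\<bar>)"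
  proof (rule continuous_le_on_closure[where S = "{-1<..<1}" and f = "\<lambda>x. \<bar>poly (phi_poly i) x\<bar>"])
    show "continuous_on (closure {-1<..<1}) (\<lambda>x. \<bar>poly (phi_poly i) x\<bar>)"
      by (intro continuous_intros)
    show "x \<in> closure {-1<..<1}" using assms by simp
    show "\<bar>poly (phi_poly i) s\<bar> \<le> (SUP s\<in>{-1<..<1}. \<bar>jacobi_phi a b i s\<bar>)" if "s \<in> {-1<..<1}" for s
      unfolding poly_phi_poly using that by (rule cSUP_upper[OF _ bdd_above_phi])
  qed
  then show ?thesis by (simp add: poly_phi_poly)
qed

text \<open>A function of norm one for a probability measure cannot be smaller than 1 throughout.
  Hence admissible weights are at least 1 and the weighted norm controls the plain one.\<close>

lemma one_le_SUP_phi: "1 \<le> (SUP s\<in>{-1<..<1}. \<bar>jacobi_phi a b i s\<bar>)" (is "1 \<le> ?S")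
proof -
  have "E (phi_poly i * phi_poly i) = 1"
    using E_P_pos[of i] by (simp add: phi_poly_def E_smult)
  moreover have "E (phi_poly i * phi_poly i) \<le> E (smult (?S\<^sup>2) 1)"
  proof (rule E_mono)
    fix x :: real assume "x \<in> {-1<..<1}"
    then have "\<bar>jacobi_phi a b i x\<bar> \<le> ?S" by (intro abs_phi_le_SUP) auto
    then have "\<bar>jacobi_phi a b i x\<bar>\<^sup>2 \<le> ?S\<^sup>2" by (intro power_mono) auto
    then show "poly (phi_poly i * phi_poly i) x \<le> poly (smult (?S\<^sup>2) 1) x"
      by (simp add: poly_phi_poly power2_eq_square)
  qed
  ultimately have "1\<^sup>2 \<le> ?S\<^sup>2" unfolding E_smult E_one by simp
  moreover have "0 \<le> ?S" using abs_phi_le_SUP[of 0 i] by force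
  ultimately show ?thesis by (rule power2_le_imp_le)
qed

lemma UPM_eq:
  "UPM a b N t M z n =
     complex_of_real (sqrt (quad_weight a b N t n)) * (\<Sum>i<M. z i * complex_of_real (jacobi_phi a b i (t n)))"
  by (simp add: UPM_def Umat_def projM_def sum_distrib_left mult_ac)

text \<open>The quadrature bound concerns real polynomials; it is applied separately to the real and
  imaginary parts of the coefficients.\<close>

lemma UPM_coercive:
  assumes "0 < \<epsilon>" "0 < N" "inj_on t {..<N}" "\<And>n. n < N \<Longrightarrow> t n \<in> {-1..1}"
    and density: "point_density N t \<le> ln (1 + \<epsilon> / 2) / markov_const / (real M)\<^sup>2"
  shows "(1 - \<epsilon>) * (\<Sum>i<M. (cmod (z i))\<^sup>2) \<le> (\<Sum>n<N. (cmod (UPM a b N t M z n))\<^sup>2)"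
proof -
  define p where "p c = (\<Sum>i<M. smult (c i) (phi_poly i))" for c
  have lower: "(1 - \<epsilon>) * (\<Sum>i<M. (c i)\<^sup>2) \<le> (\<Sum>n<N. quad_weight a b N t n * (poly (p c) (t n))\<^sup>2)" for c
  proof -
    have "\<forall>i\<ge>M. coeff (p c) i = 0" by (simp add: p_def coeff_sum coeff_phi_poly)
    from quad_sum_lower[OF this assms] show ?thesis
      unfolding p_def E_phi_expansion .
  qed
  have "(cmod (UPM a b N t M z n))\<^sup>2 =
      quad_weight a b N t n * (poly (p (\<lambda>i. Re (z i))) (t n))\<^sup>2
      + quad_weight a b N t n * (poly (p (\<lambda>i. Im (z i))) (t n))\<^sup>2" for n
    unfolding UPM_eq norm_mult power_mult_distrib cmod_power2
    using quad_weight_nonneg[of N t n]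
    by (simp add: p_def poly_sum poly_phi_poly distrib_left)
  then have "(\<Sum>n<N. (cmod (UPM a b N t M z n))\<^sup>2) =
      (\<Sum>n<N. quad_weight a b N t n * (poly (p (\<lambda>i. Re (z i))) (t n))\<^sup>2)
      + (\<Sum>n<N. quad_weight a b N t n * (poly (p (\<lambda>i. Im (z i))) (t n))\<^sup>2)"
    by (simp add: sum.distrib)
  with lower[of "\<lambda>i. Re (z i)"] lower[of "\<lambda>i. Im (z i)"] show ?thesis
    by (simp add: cmod_power2 sum.distrib distrib_left)
qed

lemma norm_suminf_phi_le:
  assumes w: "\<And>i. (SUP s\<in>{-1<..<1}. \<bar>jacobi_phi a b i s\<bar>) \<le> w i"
    and summable: "summable (\<lambda>i. w i * cmod (d i))" and x: "x \<in> {-1..1}"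
  shows "summable (\<lambda>i. d i * complex_of_real (jacobi_phi a b i x))"
    and "cmod (\<Sum>i. d i * complex_of_real (jacobi_phi a b i x)) \<le> wl1norm w d"
proof -
  have "norm (d i * complex_of_real (jacobi_phi a b i x)) \<le> w i * cmod (d i)" for i
    using mult_right_mono[OF order.trans[OF abs_phi_le_SUP[OF x] w[of i]], of "cmod (d i)"]
    by (simp add: norm_mult mult.commute)
  then show "summable (\<lambda>i. d i * complex_of_real (jacobi_phi a b i x))"
    and "cmod (\<Sum>i. d i * complex_of_real (jacobi_phi a b i x)) \<le> wl1norm w d"
    unfolding wl1norm_def using summable by (auto intro: summable_comparison_test' norm_suminf_le)
qed

end

section \<open>Truncation error and the final estimate\<close>

lemma sums_square_le_square_suminf:
  fixes f :: "nat \<Rightarrow> real"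
  assumes f: "summable f" and nn: "\<And>i. 0 \<le> f i"
  shows "summable (\<lambda>i. (f i)\<^sup>2)" and "(\<Sum>i. (f i)\<^sup>2) \<le> (suminf f)\<^sup>2"
proof -
  have le: "(f i)\<^sup>2 \<le> suminf f * f i" for i
    unfolding power2_eq_square using sum_le_suminf[OF f, of "{i}"] nn
    by (intro mult_right_mono) simp_all
  show s: "summable (\<lambda>i. (f i)\<^sup>2)"
    by (rule summable_comparison_test'[OF summable_mult[OF f, of "suminf f"], of 0]) (simp add: le)
  have "(\<Sum>i. (f i)\<^sup>2) \<le> (\<Sum>i. suminf f * f i)"
    by (intro suminf_le le s summable_mult f)
  also have "\<dots> = (suminf f)\<^sup>2" using f by (simp add: suminf_mult power2_eq_square)
  finally show "(\<Sum>i. (f i)\<^sup>2) \<le> (suminf f)\<^sup>2" .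
qed

text \<open>Tail and head of the error have disjoint supports, so their squares add; for the tail,
  the l2 norm is at most the l1 norm, and the weights are at least 1.\<close>

lemma l2norm_split_le:
  assumes w: "\<And>i. 1 \<le> w i" and summable: "summable (\<lambda>i. w i * cmod (x i - projM M x i))"
    and xc: "\<And>i. i \<ge> M \<Longrightarrow> xc i = 0"
  shows "l2norm (\<lambda>i. x i - xc i) \<le>
    wl1norm w (\<lambda>i. x i - projM M x i) + sqrt (\<Sum>i<M. (cmod (x i - xc i))\<^sup>2)"
proof -
  define d where "d i = x i - projM M x i" for i
  have le: "cmod (d i) \<le> w i * cmod (d i)" for i
    using mult_right_mono[OF w[of i], of "cmod (d i)"] by simp
  have sd: "summable (\<lambda>i. cmod (d i))"
    by (rule summable_comparison_test'[OF summable[folded d_def], of 0]) (simp add: le)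
  have nn: "0 \<le> (\<Sum>i. cmod (d i))" by (intro suminf_nonneg sd) simp
  have "(\<lambda>i. (cmod (d i))\<^sup>2 + (if i < M then (cmod (x i - xc i))\<^sup>2 else 0)) sums
      ((\<Sum>i. (cmod (d i))\<^sup>2) + (\<Sum>i<M. (cmod (x i - xc i))\<^sup>2))"
    using sums_If_finite_set[of "{..<M}" "\<lambda>i. (cmod (x i - xc i))\<^sup>2"]
    by (intro sums_add summable_sums sums_square_le_square_suminf(1)[OF sd]) auto
  moreover have "(cmod (d i))\<^sup>2 + (if i < M then (cmod (x i - xc i))\<^sup>2 else 0) = (cmod (x i - xc i))\<^sup>2" for i
    using xc by (simp add: d_def projM_def)
  ultimately have "l2norm (\<lambda>i. x i - xc i) =
      sqrt ((\<Sum>i. (cmod (d i))\<^sup>2) + (\<Sum>i<M. (cmod (x i - xc i))\<^sup>2))"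
    by (simp add: l2norm_def sums_iff)
  also have "\<dots> \<le> sqrt (\<Sum>i. (cmod (d i))\<^sup>2) + sqrt (\<Sum>i<M. (cmod (x i - xc i))\<^sup>2)"
    by (intro sqrt_add_le_add_sqrt suminf_nonneg sums_square_le_square_suminf(1)[OF sd] sum_nonneg) auto
  also have "sqrt (\<Sum>i. (cmod (d i))\<^sup>2) \<le> sqrt ((\<Sum>i. cmod (d i))\<^sup>2)"
    by (intro real_sqrt_le_mono sums_square_le_square_suminf(2)[OF sd]) simp
  also have "sqrt ((\<Sum>i. cmod (d i))\<^sup>2) \<le> wl1norm w d"
    unfolding wl1norm_def using nn suminf_le[OF le sd summable[folded d_def]] by simp
  finally show ?thesis by (simp add: d_def[abs_def])
qed

context jacobi_weight
begin

text \<open>\<open>UPM\<close> truncates x, so the residual at a sample point is the tail of f plus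
  noise, bounded uniformly in n; the quadrature weights add up to at most 1.\<close>

lemma residual_le:
  assumes "0 < N" "inj_on t {..<N}" and t: "\<And>n. n < N \<Longrightarrow> t n \<in> {-1..1}"
    and e: "\<And>n. n < N \<Longrightarrow> cmod (e n) \<le> \<eta>"
    and w: "\<And>i. (SUP s\<in>{-1<..<1}. \<bar>jacobi_phi a b i s\<bar>) \<le> w i"
    and summable: "summable (\<lambda>i. w i * cmod (x i - projM M x i))"
  shows "(\<Sum>n<N. (cmod (UPM a b N t M x n -
      complex_of_real (sqrt (quad_weight a b N t n)) * (jacobi_f a b x (t n) + e n)))\<^sup>2)
    \<le> (wl1norm w (\<lambda>i. x i - projM M x i) + \<eta>)\<^sup>2" (is "_ \<le> ?R\<^sup>2")
proof -
  define d where "d i = x i - projM M x i" for i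
  have "(\<Sum>n<N. (cmod (UPM a b N t M x n -
      complex_of_real (sqrt (quad_weight a b N t n)) * (jacobi_f a b x (t n) + e n)))\<^sup>2)
    \<le> (\<Sum>n<N. quad_weight a b N t n * ?R\<^sup>2)"
  proof (rule sum_mono)
    fix n assume "n \<in> {..<N}"
    then have n: "n < N" by simp
    define \<phi> where "\<phi> i = complex_of_real (jacobi_phi a b i (t n))" for i
    note phi = norm_suminf_phi_le[OF w summable t[OF n], folded \<phi>_def d_def]
    have "(\<lambda>i. d i * \<phi> i + (if i \<in> {..<M} then x i * \<phi> i else 0)) sums
        ((\<Sum>i. d i * \<phi> i) + (\<Sum>i<M. x i * \<phi> i))"
      by (intro sums_add summable_sums phi(1) sums_If_finite_set) simp
    moreover have "d i * \<phi> i + (if i \<in> {..<M} then x i * \<phi> i else 0) = x i * \<phi> i" for i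
      by (simp add: d_def projM_def)
    ultimately have "jacobi_f a b x (t n) = (\<Sum>i. d i * \<phi> i) + (\<Sum>i<M. x i * \<phi> i)"
      by (simp add: jacobi_f_def \<phi>_def sums_iff)
    then have eq: "UPM a b N t M x n -
        complex_of_real (sqrt (quad_weight a b N t n)) * (jacobi_f a b x (t n) + e n) =
        - complex_of_real (sqrt (quad_weight a b N t n)) * ((\<Sum>i. d i * \<phi> i) + e n)"
      by (simp add: UPM_eq \<phi>_def algebra_simps)
    have "cmod ((\<Sum>i. d i * \<phi> i) + e n) \<le> ?R"
      using phi(2) e[OF n] unfolding d_def by (intro order.trans[OF norm_triangle_ineq] add_mono)
    then have "(cmod ((\<Sum>i. d i * \<phi> i) + e n))\<^sup>2 \<le> ?R\<^sup>2" by (intro power_mono) auto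
    then show "(cmod (UPM a b N t M x n -
        complex_of_real (sqrt (quad_weight a b N t n)) * (jacobi_f a b x (t n) + e n)))\<^sup>2
        \<le> quad_weight a b N t n * ?R\<^sup>2"
      unfolding eq using quad_weight_nonneg[of N t n]
      by (simp add: norm_mult power_mult_distrib mult_left_mono)
  qed
  also have "\<dots> \<le> 1 * ?R\<^sup>2"
    unfolding sum_distrib_right[symmetric]
    by (intro mult_right_mono sum_quad_weight_le assms) simp
  finally show ?thesis by simp
qed

end

theorem theorem7p2:
  fixes a b :: real
  assumes "a > -1" and "b > -1"
  shows "\<forall>\<epsilon>::real. 0 < \<epsilon> \<and> \<epsilon> < 1 \<longrightarrow>
    (\<exists>c>0. \<forall>(N::nat) (t::nat \<Rightarrow> real) (M::nat) (x::nat \<Rightarrow> complex) (e::nat \<Rightarrow> complex) (\<eta>::real).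
       0 < N \<and> inj_on t {..<N} \<and> (\<forall>n<N. t n \<in> {-1..1}) \<and>
       point_density N t \<le> c / (real M)^2 \<and> (\<forall>n<N. cmod (e n) \<le> \<eta>) \<longrightarrow>
       (let y = (\<lambda>n. complex_of_real (sqrt (quad_weight a b N t n)) * (jacobi_f a b x (t n) + e n))
        in \<exists>xc. lsq_solution a b N t M y xc \<and> (\<forall>z. lsq_solution a b N t M y z \<longrightarrow> z = xc) \<and>
             (\<forall>w::nat \<Rightarrow> real.
                (\<forall>i. (SUP s\<in>{-1<..<1}. \<bar>jacobi_phi a b i s\<bar>) \<le> w i) \<and>
                summable (\<lambda>i. w i * cmod ((\<lambda>j. x j - projM M x j) i)) \<longrightarrow>
                l2norm (\<lambda>i. x i - xc i)
                  \<le> (1 + 1 / sqrt (1 - \<epsilon>)) * wl1norm w (\<lambda>i. x i - projM M x i)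
                    + 1 / sqrt (1 - \<epsilon>) * \<eta>)))"
proof (intro allI impI, elim conjE)
  interpret jacobi_weight a b using assms by unfold_locales
  fix \<epsilon> :: real assume \<epsilon>: "0 < \<epsilon>" "\<epsilon> < 1"
  show "\<exists>c>0. \<forall>(N::nat) (t::nat \<Rightarrow> real) (M::nat) (x::nat \<Rightarrow> complex) (e::nat \<Rightarrow> complex) (\<eta>::real).
       0 < N \<and> inj_on t {..<N} \<and> (\<forall>n<N. t n \<in> {-1..1}) \<and>
       point_density N t \<le> c / (real M)^2 \<and> (\<forall>n<N. cmod (e n) \<le> \<eta>) \<longrightarrow>
       (let y = (\<lambda>n. complex_of_real (sqrt (quad_weight a b N t n)) * (jacobi_f a b x (t n) + e n))
        in \<exists>xc. lsq_solution a b N t M y xc \<and> (\<forall>z. lsq_solution a b N t M y z \<longrightarrow> z = xc) \<and>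
             (\<forall>w::nat \<Rightarrow> real.
                (\<forall>i. (SUP s\<in>{-1<..<1}. \<bar>jacobi_phi a b i s\<bar>) \<le> w i) \<and>
                summable (\<lambda>i. w i * cmod ((\<lambda>j. x j - projM M x j) i)) \<longrightarrow>
                l2norm (\<lambda>i. x i - xc i)
                  \<le> (1 + 1 / sqrt (1 - \<epsilon>)) * wl1norm w (\<lambda>i. x i - projM M x i)
                    + 1 / sqrt (1 - \<epsilon>) * \<eta>))"
  \<comment> \<open>The value of c that makes the density times \<open>markov_const\<close> M^2 at
    most ln (1 + \<epsilon>/2), for M > 0.\<close>
  proof (intro exI[of _ "ln (1 + \<epsilon> / 2) / markov_const"] conjI allI impI, goal_cases)
    case 1
    show ?case using \<epsilon> markov_const_pos by simp
  next
    case (2 N t M x e \<eta>)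
    define y where "y n = complex_of_real (sqrt (quad_weight a b N t n)) * (jacobi_f a b x (t n) + e n)" for n
    have UPM: "UPM a b N t M z n = (\<Sum>i<M. Umat a b N t n i * z i)" for z n
      by (simp add: UPM_def projM_def)
    have "(1 - \<epsilon>) * (\<Sum>i<M. (cmod (z i))\<^sup>2) \<le> (\<Sum>n<N. (cmod (\<Sum>i<M. Umat a b N t n i * z i))\<^sup>2)" for z
      using UPM_coercive[of \<epsilon> N t M z] 2 \<epsilon> by (simp add: UPM)
    from least_squares[where \<kappa> = "1 - \<epsilon>" and M = M and N = N and A = "Umat a b N t" and y = y,
        folded UPM, OF _ this[folded UPM]]
    obtain xc where xc: "\<And>i. i \<ge> M \<Longrightarrow> xc i = 0"
      "\<And>z. (\<Sum>n<N. (cmod (UPM a b N t M xc n - y n))\<^sup>2) \<le> (\<Sum>n<N. (cmod (UPM a b N t M z n - y n))\<^sup>2)"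
      "\<And>z. (\<Sum>n<N. (cmod (UPM a b N t M z n - y n))\<^sup>2) \<le> (\<Sum>n<N. (cmod (UPM a b N t M xc n - y n))\<^sup>2)
        \<Longrightarrow> \<forall>i\<ge>M. z i = 0 \<Longrightarrow> z = xc"
      "\<And>z. (1 - \<epsilon>) * (\<Sum>i<M. (cmod (z i - xc i))\<^sup>2) \<le> (\<Sum>n<N. (cmod (UPM a b N t M z n - y n))\<^sup>2)"
      using \<epsilon> by auto
    have "lsq_solution a b N t M y xc"
      using xc(1,2) by (simp add: lsq_solution_def lsq_residual_def)
    moreover have "z = xc" if "lsq_solution a b N t M y z" for z
      using that xc(1) by (intro xc(3)) (auto simp: lsq_solution_def lsq_residual_def)
    moreover have "l2norm (\<lambda>i. x i - xc i)
        \<le> (1 + 1 / sqrt (1 - \<epsilon>)) * wl1norm w (\<lambda>i. x i - projM M x i) + 1 / sqrt (1 - \<epsilon>) * \<eta>"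
      if w: "\<And>i. (SUP s\<in>{-1<..<1}. \<bar>jacobi_phi a b i s\<bar>) \<le> w i"
        and summable: "summable (\<lambda>i. w i * cmod (x i - projM M x i))" for w
    proof -
      define R where "R = wl1norm w (\<lambda>i. x i - projM M x i)"
      have w1: "1 \<le> w i" for i using one_le_SUP_phi w by (rule order.trans)
      have "0 \<le> w i * cmod (x i - projM M x i)" for i
        using w1[of i] by (intro mult_nonneg_nonneg) auto
      then have "0 \<le> R" unfolding R_def wl1norm_def by (intro suminf_nonneg summable)
      \<comment> \<open>There is at least one sample, since N > 0, and its noise is bounded by
        \<eta>.\<close>
      moreover have "0 \<le> \<eta>" using 2 norm_ge_zero order.trans by blast
      ultimately have "0 \<le> R + \<eta>" by simp
      \<comment> \<open>Stability with x as competitor: only its first M coordinates enter, so x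
        stands for its truncation.\<close>
      have "(1 - \<epsilon>) * (\<Sum>i<M. (cmod (x i - xc i))\<^sup>2) \<le> (R + \<eta>)\<^sup>2"
        using xc(4)[of x] residual_le[of N t e \<eta> w x M] 2 w summable
        unfolding y_def R_def by (meson order.trans)
      then have "(\<Sum>i<M. (cmod (x i - xc i))\<^sup>2) \<le> (R + \<eta>)\<^sup>2 / (1 - \<epsilon>)"
        using \<epsilon> by (simp add: pos_le_divide_eq mult.commute)
      then have "sqrt (\<Sum>i<M. (cmod (x i - xc i))\<^sup>2) \<le> sqrt ((R + \<eta>)\<^sup>2 / (1 - \<epsilon>))"
        by (rule real_sqrt_le_mono)
      also have "\<dots> = (R + \<eta>) / sqrt (1 - \<epsilon>)"
        using \<open>0 \<le> R + \<eta>\<close> by (simp add: real_sqrt_divide)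
      finally have "sqrt (\<Sum>i<M. (cmod (x i - xc i))\<^sup>2) \<le> (R + \<eta>) / sqrt (1 - \<epsilon>)" .
      with l2norm_split_le[of w x M xc, OF w1 summable xc(1)]
      have "l2norm (\<lambda>i. x i - xc i) \<le> R + (R + \<eta>) / sqrt (1 - \<epsilon>)"
        unfolding R_def by linarith
      also have "\<dots> = (1 + 1 / sqrt (1 - \<epsilon>)) * R + 1 / sqrt (1 - \<epsilon>) * \<eta>"
        by (simp add: distrib_right add_divide_distrib)
      finally show ?thesis unfolding R_def .
    qed
    ultimately show ?case
      unfolding y_def[abs_def, symmetric] Let_def by blast
  qed
qed

end
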